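(* Let $X$ be a symmetric Banach sequence lattice. Then there is a constant $C>0$ (independent of $n$) such that $$\inf_{m\le n}\Big(\frac{\varphi_{X'}(m-1)}{\varphi_{X'}(n)}\Big)^{\frac{m-1}m}\le C\,K(B_{X_n},\Lambda_T)\quad\text{for all }n,$$ and, for $1\le r\le 2$, there is a constant $C>0$ (independent of $n$) such that $$K(B_{X_n},\Lambda_T)\le C\frac{(\log n)^{1/r'}}{\varphi_{X'}(n)}\|\mathrm{id}:X_n\to\ell_r^n\|\quad\text{for all }n.$$
   Context: $X$ is a Banach space of complex sequences with the ideal property, symmetric meaning $\|(x_{\sigma(k)})\|=\|x\|$ for all permutations $\sigma$. $X_n$ is $\mathbb{C}^n$ with $\|z\|=\|\sum_{k\le n}|z_k|e_k\|_X$, $B_{X_n}$ its open unit ball. $X'$ is the Köthe dual and $\varphi_{X'}(k)=\|\sum_{j\le k}e_j\|_{X'}$. $r'$ is the conjugate exponent. $\Lambda_T$ is the set of all finitely supported multi-indices with entries in $\{0,1\}$. $K(B_{X_n},J)$ is the Bohr radius: the supremum of $r\in(0,1)$ with $\sup_{z\in rB_{X_n}}\sum_{\alpha\in J}|c_\alpha(f)z^\alpha|\le\sup_{B_{X_n}}|f|$ for all bounded holomorphic $f$ on $B_{X_n}$ with Taylor coefficients $c_\alpha(f)=\partial^\alpha f(0)/\alpha!$ vanishing outside $J$.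
   Formalization: The upper bound is stated for all n ≥ 2 instead of all n: at n = 1 and r > 1 its right-hand side is 0 because log 1 = 0, while the Bohr radius is positive. In the lower bound, the term m = 1 is read as 1 (0^0 = 1). *)

theory Defs
  imports "HOL-Analysis.Analysis"
begin

text \<open>Sequences are functions nat \<Rightarrow> complex (indices start at 0).
  The Banach sequence space X is given by a carrier Xs and a norm nX.\<close>

definition unit_seq :: "nat \<Rightarrow> nat \<Rightarrow> complex" where
  "unit_seq k = (\<lambda>j. if j = k then 1 else 0)"

definition symmetric_banach_seq_lattice ::
  "(nat \<Rightarrow> complex) set \<Rightarrow> ((nat \<Rightarrow> complex) \<Rightarrow> real) \<Rightarrow> bool" where
  "symmetric_banach_seq_lattice Xs nX \<longleftrightarrow>
     \<comment> \<open>complex vector space of sequences\<close>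
     (\<lambda>_. 0) \<in> Xs
   \<and> (\<forall>x\<in>Xs. \<forall>y\<in>Xs. (\<lambda>k. x k + y k) \<in> Xs)
   \<and> (\<forall>c. \<forall>x\<in>Xs. (\<lambda>k. c * x k) \<in> Xs)
     \<comment> \<open>norm axioms\<close>
   \<and> (\<forall>x\<in>Xs. 0 \<le> nX x \<and> (nX x = 0 \<longleftrightarrow> x = (\<lambda>_. 0)))
   \<and> (\<forall>c. \<forall>x\<in>Xs. nX (\<lambda>k. c * x k) = cmod c * nX x)
   \<and> (\<forall>x\<in>Xs. \<forall>y\<in>Xs. nX (\<lambda>k. x k + y k) \<le> nX x + nX y)
     \<comment> \<open>completeness\<close>
   \<and> (\<forall>s::nat \<Rightarrow> nat \<Rightarrow> complex. (\<forall>i. s i \<in> Xs) \<longrightarrow>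
        (\<forall>e>0. \<exists>N. \<forall>i\<ge>N. \<forall>j\<ge>N. nX (\<lambda>k. s i k - s j k) < e) \<longrightarrow>
        (\<exists>x\<in>Xs. \<forall>e>0. \<exists>N. \<forall>i\<ge>N. nX (\<lambda>k. s i k - x k) < e))
     \<comment> \<open>ideal (lattice) property\<close>
   \<and> (\<forall>x\<in>Xs. \<forall>y. (\<forall>k. cmod (y k) \<le> cmod (x k)) \<longrightarrow> y \<in> Xs \<and> nX y \<le> nX x)
     \<comment> \<open>symmetry\<close>
   \<and> (\<forall>\<sigma>. bij \<sigma> \<longrightarrow> (\<forall>x\<in>Xs. (x \<circ> \<sigma>) \<in> Xs \<and> nX (x \<circ> \<sigma>) = nX x))
     \<comment> \<open>X is a sequence space containing the unit vectors\<close>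
   \<and> (\<forall>k. unit_seq k \<in> Xs)"

definition cvec :: "nat \<Rightarrow> (nat \<Rightarrow> complex) set" where
  "cvec n = {z. \<forall>k\<ge>n. z k = 0}"

definition normXn :: "((nat \<Rightarrow> complex) \<Rightarrow> real) \<Rightarrow> nat \<Rightarrow> (nat \<Rightarrow> complex) \<Rightarrow> real" where
  "normXn nX n z = nX (\<lambda>k. if k < n then complex_of_real (cmod (z k)) else 0)"

definition ballXn :: "((nat \<Rightarrow> complex) \<Rightarrow> real) \<Rightarrow> nat \<Rightarrow> real \<Rightarrow> (nat \<Rightarrow> complex) set" where
  "ballXn nX n r = {z \<in> cvec n. normXn nX n z < r}"

text \<open>Fundamental function of the Koethe dual:
  \<phi>_{X'}(k) = \<parallel>\<Sum>_{j\<le>k} e_j\<parallel>_{X'} = sup_{\<parallel>x\<parallel>_X \<le> 1} \<Sum>_{j\<le>k} |x_j| (first k coordinates).\<close>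
definition phi_dual :: "(nat \<Rightarrow> complex) set \<Rightarrow> ((nat \<Rightarrow> complex) \<Rightarrow> real) \<Rightarrow> nat \<Rightarrow> real" where
  "phi_dual Xs nX k = (SUP x \<in> {x \<in> Xs. nX x \<le> 1}. \<Sum>j<k. cmod (x j))"

text \<open>Holomorphy on an open subset of C^n (separately holomorphic; equivalent by Hartogs).\<close>
definition holo_on :: "nat \<Rightarrow> ((nat \<Rightarrow> complex) \<Rightarrow> complex) \<Rightarrow> (nat \<Rightarrow> complex) set \<Rightarrow> bool" where
  "holo_on n f U \<longleftrightarrow> (\<forall>z\<in>U. \<forall>k<n. (\<lambda>w. f (z(k := w))) field_differentiable (at (z k)))"

definition partial :: "nat \<Rightarrow> ((nat \<Rightarrow> complex) \<Rightarrow> complex) \<Rightarrow> (nat \<Rightarrow> complex) \<Rightarrow> complex" where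
  "partial k f = (\<lambda>z. deriv (\<lambda>w. f (z(k := w))) (z k))"

definition mindex :: "nat \<Rightarrow> (nat \<Rightarrow> nat) set" where
  "mindex n = {\<alpha>. \<forall>k\<ge>n. \<alpha> k = 0}"

definition partial_multi :: "nat \<Rightarrow> (nat \<Rightarrow> nat) \<Rightarrow> ((nat \<Rightarrow> complex) \<Rightarrow> complex) \<Rightarrow> (nat \<Rightarrow> complex) \<Rightarrow> complex" where
  "partial_multi n \<alpha> f = foldr (\<lambda>k g. (partial k ^^ \<alpha> k) g) [0..<n] f"

definition taylor_coeff :: "nat \<Rightarrow> (nat \<Rightarrow> nat) \<Rightarrow> ((nat \<Rightarrow> complex) \<Rightarrow> complex) \<Rightarrow> complex" where
  "taylor_coeff n \<alpha> f = partial_multi n \<alpha> f (\<lambda>_. 0) / of_nat (\<Prod>k<n. fact (\<alpha> k))"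

definition mpow :: "nat \<Rightarrow> (nat \<Rightarrow> complex) \<Rightarrow> (nat \<Rightarrow> nat) \<Rightarrow> complex" where
  "mpow n z \<alpha> = (\<Prod>k<n. z k ^ \<alpha> k)"

definition LambdaT :: "nat \<Rightarrow> (nat \<Rightarrow> nat) set" where
  "LambdaT n = {\<alpha> \<in> mindex n. \<forall>k. \<alpha> k \<le> 1}"

text \<open>Bohr radius K(B_{X_n}, J) for a (finite) index set J \<subseteq> mindex n.\<close>
definition bohr_radius :: "((nat \<Rightarrow> complex) \<Rightarrow> real) \<Rightarrow> nat \<Rightarrow> (nat \<Rightarrow> nat) set \<Rightarrow> real" where
  "bohr_radius nX n J = Sup {r. 0 < r \<and> r < 1 \<and>
     (\<forall>f. holo_on n f (ballXn nX n 1)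
          \<and> (\<exists>M. \<forall>z\<in>ballXn nX n 1. cmod (f z) \<le> M)
          \<and> (\<forall>\<alpha>\<in>mindex n. \<alpha> \<notin> J \<longrightarrow> taylor_coeff n \<alpha> f = 0)
        \<longrightarrow> (\<forall>z\<in>ballXn nX n r.
              (\<Sum>\<alpha>\<in>J. cmod (taylor_coeff n \<alpha> f * mpow n z \<alpha>))
                \<le> (SUP w\<in>ballXn nX n 1. cmod (f w))))}"

definition id_norm_lr :: "((nat \<Rightarrow> complex) \<Rightarrow> real) \<Rightarrow> nat \<Rightarrow> real \<Rightarrow> real" where
  "id_norm_lr nX n r = (SUP z \<in> {z \<in> cvec n. normXn nX n z \<le> 1}.
       (\<Sum>k<n. cmod (z k) powr r) powr (1 / r))"

text \<open>The ratio (\<phi>_{X'}(m-1)/\<phi>_{X'}(n))^{(m-1)/m}, with 0^0 = 1 for m = 1.\<close>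
definition lower_ratio :: "(nat \<Rightarrow> complex) set \<Rightarrow> ((nat \<Rightarrow> complex) \<Rightarrow> real) \<Rightarrow> nat \<Rightarrow> nat \<Rightarrow> real" where
  "lower_ratio Xs nX n m = (if m = 1 then 1 else
     (phi_dual Xs nX (m - 1) / phi_dual Xs nX n) powr ((real m - 1) / real m))"

end

theory Submission
  imports Defs "HOL-Complex_Analysis.Complex_Analysis"
begin

text \<open>A bounded holomorphic function on the ball with Taylor coefficients supported in \<open>\<Lambda>\<^sub>T\<close> is a
  polynomial \<open>\<Sum>\<^sub>S c\<^sub>S z\<^sub>S\<close>, affine in each variable, with \<open>S\<close> ranging over the subsets of
  \<open>{..<n}\<close>. Averaging over cyclic shifts gives \<open>\<phi>\<^sub>X(k) \<phi>\<^sub>X\<^sub>'(k) \<le> k\<close> for the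
  fundamental functions of \<open>X\<close> and its dual.

  Lower estimate: if \<open>P = \<Sum>\<^sub>|\<^sub>S\<^sub>|\<^sub>=\<^sub>m c\<^sub>S z\<^sub>S\<close> is bounded by \<open>K\<close> on the ball and
  \<open>|T| = m - 1\<close>, then taking mixed differences of \<open>P\<close> in the directions of \<open>T\<close> with step
  \<open>1 / \<phi>\<^sub>X(m - 1)\<close> bounds \<open>\<Sum>\<^sub>k |c(T \<union> {k})| |z\<^sub>k|\<close> by \<open>2\<^sup>m K \<phi>\<^sub>X(m - 1)\<^sup>m\<^sup>-\<^sup>1\<close>.
  Multiplying by \<open>|z\<^sub>T|\<close> and summing over \<open>T\<close> costs a factor
  \<open>\<phi>\<^sub>X\<^sub>'(n)\<^sup>m\<^sup>-\<^sup>1 / (m - 1)!\<close>. Since the homogeneous parts satisfy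
  \<open>|P\<^sub>m| \<le> 2 (sup |f| - |c\<^sub>0|)\<close>, the resulting bounds add up to Bohr's inequality.

  Upper estimate: with \<open>m = \<lceil>ln n\<rceil>\<close>, there are signs for which \<open>\<Sum>\<^sub>|\<^sub>S\<^sub>|\<^sub>=\<^sub>m \<epsilon>\<^sub>S z\<^sub>S\<close> and all
  its mixed derivatives are small on the \<open>\<ell>\<^sub>2\<close> ball (exponential moments and a union bound).
  Splitting \<open>z\<close> into large and small coordinates turns this into a bound \<open>C\<^sup>m m\<^sup>-\<^sup>m\<^sup>/\<^sup>r\<close> on the
  \<open>\<ell>\<^sub>r\<close> ball, and Bohr's inequality at the constant vector gives the claim.\<close>

section \<open>Separately holomorphic functions with tetrahedral Taylor series\<close>

lemma higher_deriv_le_if_bounded: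
  assumes "g holomorphic_on ball 0 R" "\<And>w. w \<in> ball 0 R \<Longrightarrow> cmod (g w) \<le> M" "0 < s" "s < R"
  shows "cmod ((deriv ^^ k) g 0) \<le> fact k * M / s ^ k"
proof (rule Cauchy_inequality)
  have "cball 0 s \<subseteq> ball (0::complex) R" using assms by auto
  then show "continuous_on (cball 0 s) g"
    using assms(1) holomorphic_on_imp_continuous_on continuous_on_subset by blast
  show "g holomorphic_on ball 0 s"
    using assms holomorphic_on_subset by (metis ball_subset_ball_iff dist_self add_0 less_imp_le)
qed (use assms in auto)

text \<open>Cauchy estimates at radius \<open>R / 2\<close> dominate the tail beyond degree
  \<open>k\<close> by a geometric series of ratio at most \<open>1/2\<close>. The constant involves
  only \<open>M\<close>, \<open>R\<close> and \<open>k\<close>, so the coefficient of degree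
  \<open>k\<close> is a limit of such quotients uniformly over all functions bounded by
  \<open>M\<close>.\<close>

lemma power_series_remainder_le:
  assumes hol: "g holomorphic_on ball 0 R" and bd: "\<And>w. w \<in> ball 0 R \<Longrightarrow> cmod (g w) \<le> M"
    and "0 < R" "w \<noteq> 0" "cmod w \<le> R / 4"
  shows "cmod ((g w - (\<Sum>i<k. (deriv ^^ i) g 0 / fact i * w ^ i)) / w ^ k - (deriv ^^ k) g 0 / fact k)
          \<le> 2 * M / (R / 2) ^ Suc k * cmod w"
proof -
  define a where "a i = (deriv ^^ i) g 0 / fact i" for i
  define s where "s = R / 2"
  have s: "0 < s" "s < R" "cmod w / s \<le> 1 / 2" using assms by (auto simp: s_def field_simps)
  have a: "cmod (a i) \<le> M / s ^ i" for i
    using higher_deriv_le_if_bounded[OF hol bd s(1,2), of i] by (simp add: a_def norm_divide field_simps)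
  have M: "M \<ge> 0" using bd[of 0] \<open>0 < R\<close> by (smt (verit) centre_in_ball norm_ge_zero)
  have "(\<lambda>i. a i * w ^ i) sums g w"
    using holomorphic_power_series[OF hol, of w] assms by (auto simp: a_def)
  from sums_split_initial_segment[OF this, of "Suc k"]
  have 1: "(\<lambda>i. a (i + Suc k) * w ^ (i + Suc k)) sums (g w - (\<Sum>i<Suc k. a i * w ^ i))" .
  define c where "c = M / s ^ Suc k * cmod w ^ Suc k"
  have 2: "(\<lambda>i. c * (1/2) ^ i) sums (c * (1 / (1 - 1/2)))"
    by (intro sums_mult geometric_sums) auto
  have 3: "cmod (a (i + Suc k) * w ^ (i + Suc k)) \<le> c * (1/2) ^ i" for i
  proof -
    have "cmod (a (i + Suc k) * w ^ (i + Suc k)) \<le> M / s ^ (i + Suc k) * cmod w ^ (i + Suc k)"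
      unfolding norm_mult norm_power by (intro mult_right_mono a) auto
    also have "\<dots> = c * (cmod w / s) ^ i"
      by (simp add: c_def power_add power_divide mult_ac)
    also have "\<dots> \<le> c * (1/2) ^ i"
      using s M by (intro mult_left_mono power_mono) (auto simp: c_def)
    finally show ?thesis .
  qed
  have 4: "cmod (g w - (\<Sum>i<Suc k. a i * w ^ i)) \<le> c * (1 / (1 - 1/2))"
    using norm_sums_le[OF 1 2 3] .
  have "(g w - (\<Sum>i<k. a i * w ^ i)) / w ^ k - a k = (g w - (\<Sum>i<Suc k. a i * w ^ i)) / w ^ k"
    using \<open>w \<noteq> 0\<close> by (simp add: field_simps)
  then have "cmod ((g w - (\<Sum>i<k. a i * w ^ i)) / w ^ k - a k) \<le> c * 2 / cmod w ^ k"
    using 4 by (simp add: norm_divide norm_power divide_right_mono)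
  also have "\<dots> = 2 * M / s ^ Suc k * cmod w"
    using \<open>w \<noteq> 0\<close> by (simp add: c_def)
  finally show ?thesis by (simp add: a_def s_def)
qed

text \<open>Each Taylor coefficient is a uniform limit of quotients built from values of
  \<open>F\<close> and lower coefficients, so induction on \<open>k\<close> and Weierstrass'
  convergence theorem apply. Separate holomorphy and a common bound suffice for this
  argument.\<close>

lemma holomorphic_on_higher_deriv_parameter:
  assumes "open U" "0 < R"
    and hw: "\<And>v. v \<in> U \<Longrightarrow> F v holomorphic_on ball 0 R"
    and hv: "\<And>w. w \<in> ball 0 R \<Longrightarrow> (\<lambda>v. F v w) holomorphic_on U"
    and bd: "\<And>v w. v \<in> U \<Longrightarrow> w \<in> ball 0 R \<Longrightarrow> cmod (F v w) \<le> M"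
  shows "(\<lambda>v. (deriv ^^ k) (F v) 0) holomorphic_on U"
proof (induction k rule: less_induct)
  case (less k)
  define a where "a i v = (deriv ^^ i) (F v) 0 / fact i" for i v
  \<comment> \<open>These points tend to 0 and stay within \<open>R / 4\<close>, where the remainder
    estimate applies.\<close>
  define w where "w N = complex_of_real (R / 4 / real (Suc N))" for N
  define h where "h N v = (F v (w N) - (\<Sum>i<k. a i v * w N ^ i)) / w N ^ k" for N v
  have w: "w N \<noteq> 0" "cmod (w N) = R / 4 / real (Suc N)" for N
    using \<open>0 < R\<close> by (auto simp: w_def norm_divide simp del: of_nat_Suc)
  have w4: "cmod (w N) \<le> R / 4" for N
    unfolding w(2) using \<open>0 < R\<close> by (simp add: field_simps)
  have wb: "w N \<in> ball 0 R" for N using w4[of N] \<open>0 < R\<close> by auto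
  have hol_h: "h N holomorphic_on U" for N
    unfolding h_def a_def using w(1) less.IH hv[OF wb]
    by (intro holomorphic_intros) auto
  define c where "c = 2 * M / (R / 2) ^ Suc k"
  have est: "dist (h N v) (a k v) \<le> c * cmod (w N)" if "v \<in> U" for N v
    using power_series_remainder_le[OF hw[OF that] bd[OF that] \<open>0 < R\<close> w(1) w4, of N k]
    by (simp add: h_def a_def dist_norm c_def)
  have lim: "(\<lambda>N. c * cmod (w N)) \<longlonglongrightarrow> 0"
  proof -
    have "(\<lambda>N. (c * (R / 4)) * (1 / real (Suc N))) \<longlonglongrightarrow> (c * (R / 4)) * 0"
      by (intro tendsto_mult tendsto_const LIMSEQ_Suc lim_1_over_n)
    then show ?thesis by (simp add: w(2))
  qed
  have ul: "uniform_limit U h (a k) sequentially"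
  proof (rule uniform_limitI)
    fix e :: real assume "e > 0"
    then have "\<forall>\<^sub>F N in sequentially. c * cmod (w N) < e"
      using order_tendstoD(2)[OF lim] by auto
    then show "\<forall>\<^sub>F N in sequentially. \<forall>v\<in>U. dist (h N v) (a k v) < e"
      by eventually_elim (use est in \<open>fastforce intro: le_less_trans\<close>)
  qed
  have "a k holomorphic_on U"
  proof (rule holomorphic_uniform_sequence[OF \<open>open U\<close> hol_h])
    fix x assume "x \<in> U"
    then obtain d where "0 < d" "cball x d \<subseteq> U" using \<open>open U\<close> open_contains_cball by blast
    then show "\<exists>d>0. cball x d \<subseteq> U \<and> uniform_limit (cball x d) h (a k) sequentially"
      using ul uniform_limit_on_subset by blast
  qed
  then have "(\<lambda>v. fact k * a k v) holomorphic_on U" by (intro holomorphic_intros)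
  then show ?case by (simp add: a_def)
qed

section \<open>Iterated partial derivatives, and multi-indices as sets\<close>

lemma funpow_partial:
  "(partial k ^^ j) f z = (deriv ^^ j) (\<lambda>w. f (z(k := w))) (z k)"
proof (induction j arbitrary: z)
  case (Suc j)
  have "(partial k ^^ Suc j) f z = deriv (\<lambda>w. (partial k ^^ j) f (z(k := w))) (z k)"
    by (simp add: partial_def[of k "(partial k ^^ j) f"])
  moreover have "(partial k ^^ j) f (z(k := w)) = (deriv ^^ j) (\<lambda>v. f (z(k := v))) w" for w
    using Suc.IH[of "z(k := w)"] by (simp only: fun_upd_upd fun_upd_same)
  ultimately show ?case by (simp only: funpow.simps o_apply)
qed simp

text \<open>The \<open>foldr\<close> lets the last variable act first on \<open>f\<close>;
  inductions on \<open>n\<close> therefore peel off the variable of largest index.\<close>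

lemma partial_multi_Suc: "partial_multi (Suc n) \<alpha> f = partial_multi n \<alpha> ((partial n ^^ \<alpha> n) f)"
  by (simp add: partial_multi_def)

lemma partial_multi_cong:
  assumes "\<And>k. k < n \<Longrightarrow> \<alpha> k = \<beta> k" shows "partial_multi n \<alpha> f = partial_multi n \<beta> f"
  unfolding partial_multi_def by (rule foldr_cong) (use assms in auto)

text \<open>Tetrahedral multi-indices are indicator functions, so monomials can be indexed by the
  subsets of \<open>{..<n}\<close>.\<close>

definition set_index :: "nat set \<Rightarrow> nat \<Rightarrow> nat" where
  "set_index S = (\<lambda>k. if k \<in> S then 1 else 0)"

lemma set_index_in_LambdaT: "S \<subseteq> {..<n} \<Longrightarrow> set_index S \<in> LambdaT n"
  by (auto simp: set_index_def LambdaT_def mindex_def)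

lemma bij_betw_set_index: "bij_betw set_index (Pow {..<n}) (LambdaT n)"
proof (rule bij_betwI[where g = "\<lambda>\<alpha>. {k. \<alpha> k = 1}"])
  show "set_index \<in> Pow {..<n} \<rightarrow> LambdaT n" using set_index_in_LambdaT by auto
  show "(\<lambda>\<alpha>. {k. \<alpha> k = 1}) \<in> LambdaT n \<rightarrow> Pow {..<n}"
    by (force simp: LambdaT_def mindex_def not_less[symmetric])
  show "\<And>S. S \<in> Pow {..<n} \<Longrightarrow> {k. set_index S k = 1} = S" by (auto simp: set_index_def)
  show "set_index {k. \<alpha> k = 1} = \<alpha>" if "\<alpha> \<in> LambdaT n" for \<alpha>
  proof
    fix k
    have "\<alpha> k \<le> 1" using that by (auto simp: LambdaT_def)
    then show "set_index {k. \<alpha> k = 1} k = \<alpha> k" by (auto simp: set_index_def)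
  qed
qed

lemma mpow_set_index: "S \<subseteq> {..<n} \<Longrightarrow> mpow n z (set_index S) = (\<Prod>i\<in>S. z i)"
proof -
  assume S: "S \<subseteq> {..<n}"
  have "mpow n z (set_index S) = (\<Prod>k<n. if k \<in> S then z k else 1)"
    unfolding mpow_def set_index_def by (rule prod.cong) auto
  also have "\<dots> = (\<Prod>k\<in>{k. k < n \<and> k \<in> S}. z k)"
    by (simp add: prod.If_cases Int_def lessThan_def)
  also have "{k. k < n \<and> k \<in> S} = S" using S by auto
  finally show ?thesis .
qed

lemma sum_Pow_insert:
  fixes g :: "'b set \<Rightarrow> 'a::comm_monoid_add"
  assumes "finite A" "a \<notin> A"
  shows "(\<Sum>S\<in>Pow (insert a A). g S) = (\<Sum>S\<in>Pow A. g S) + (\<Sum>S\<in>Pow A. g (insert a S))"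
proof -
  have "inj_on (insert a) (Pow A)" using assms by (auto simp: inj_on_def)
  then have "(\<Sum>S\<in>insert a ` Pow A. g S) = (\<Sum>S\<in>Pow A. g (insert a S))"
    by (simp add: sum.reindex)
  moreover have "Pow A \<inter> insert a ` Pow A = {}" using assms by auto
  ultimately show ?thesis
    using assms by (simp add: Pow_insert sum.union_disjoint)
qed

section \<open>Tetrahedral polynomials and the expansion on polydiscs\<close>

definition tetra :: "nat set \<Rightarrow> (nat set \<Rightarrow> complex) \<Rightarrow> (nat \<Rightarrow> complex) \<Rightarrow> complex" where
  "tetra V c z = (\<Sum>S\<in>Pow V. c S * (\<Prod>i\<in>S. z i))"

text \<open>Being a product, a polydisc lets each variable move freely while the others are fixed,
  which the ball \<open>ballXn nX n 1\<close> does not.\<close>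

definition polydisc :: "nat \<Rightarrow> (nat \<Rightarrow> real) \<Rightarrow> (nat \<Rightarrow> complex) set" where
  "polydisc n \<rho> = {z \<in> cvec n. \<forall>i<n. cmod (z i) < \<rho> i}"

text \<open>Induction on \<open>n\<close> by expanding in the last variable. Its Taylor coefficients
  are bounded, separately holomorphic functions of the remaining variables, so the induction
  hypothesis covers them, and it forces those of degree at least 2 to vanish.\<close>

lemma multiaffine_expansion:
  assumes "\<And>i. i < n \<Longrightarrow> 0 < \<rho> i"
    and "holo_on n f (polydisc n \<rho>)"
    and "\<And>z. z \<in> polydisc n \<rho> \<Longrightarrow> cmod (f z) \<le> M"
    and "\<And>\<alpha>. \<alpha> \<in> mindex n \<Longrightarrow> \<alpha> \<notin> LambdaT n \<Longrightarrow> partial_multi n \<alpha> f (\<lambda>_. 0) = 0"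
    and "z \<in> polydisc n \<rho>"
  shows "f z = tetra {..<n} (\<lambda>S. partial_multi n (set_index S) f (\<lambda>_. 0)) z"
  using assms unfolding tetra_def
proof (induction n arbitrary: f M z)
  case 0
  then have "z = (\<lambda>_. 0)" by (auto simp: polydisc_def cvec_def)
  then show ?case by (simp add: partial_multi_def)
next
  case (Suc n)
  define R where "R = \<rho> n"
  have R: "0 < R" using Suc.prems(1) by (simp add: R_def)
  define g where "g k = (partial n ^^ k) f" for k
  have upd: "u(n := w) \<in> polydisc (Suc n) \<rho>" if "u \<in> polydisc n \<rho>" "w \<in> ball 0 R" for u w
    using that by (auto simp: polydisc_def cvec_def R_def less_Suc_eq)
  have last: "(\<lambda>w. f (u(n := w))) holomorphic_on ball 0 R" if "u \<in> polydisc n \<rho>" for u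
    unfolding holomorphic_on_def
  proof
    fix w :: complex assume "w \<in> ball 0 R"
    from upd[OF that this] Suc.prems(2)
    have "(\<lambda>v. f ((u(n := w))(n := v))) field_differentiable at ((u(n := w)) n)"
      unfolding holo_on_def by blast
    then show "(\<lambda>w. f (u(n := w))) field_differentiable at w within ball 0 R"
      by (simp add: field_differentiable_at_within)
  qed
  have lastbd: "cmod (f (u(n := w))) \<le> M" if "u \<in> polydisc n \<rho>" "w \<in> ball 0 R" for u w
    using Suc.prems(3) upd that by blast
  have g: "g k u = (deriv ^^ k) (\<lambda>w. f (u(n := w))) 0" if "u \<in> polydisc n \<rho>" for k u
    using that by (simp add: g_def funpow_partial polydisc_def cvec_def)
  \<comment> \<open>The bound may depend on \<open>k\<close>: the induction hypothesis holds for
    every bound \<open>M\<close>.\<close>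
  have g_bd: "cmod (g k u) \<le> fact k * M / (R / 2) ^ k" if "u \<in> polydisc n \<rho>" for k u
    unfolding g[OF that]
    using higher_deriv_le_if_bounded[OF last[OF that] lastbd[OF that]] R by simp
  have g_holo: "holo_on n (g k) (polydisc n \<rho>)" for k
    unfolding holo_on_def
  proof (intro ballI allI impI)
    fix u j assume u: "u \<in> polydisc n \<rho>" and j: "j < n"
    have uv: "u(j := v) \<in> polydisc n \<rho>" if "v \<in> ball 0 (\<rho> j)" for v
      using that u j by (auto simp: polydisc_def cvec_def)
    have "(\<lambda>v. (deriv ^^ k) (\<lambda>w. f (u(j := v, n := w))) 0) holomorphic_on ball 0 (\<rho> j)"
    proof (rule holomorphic_on_higher_deriv_parameter[OF open_ball R])
      show "(\<lambda>w. f (u(j := v, n := w))) holomorphic_on ball 0 R" if "v \<in> ball 0 (\<rho> j)" for v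
        using last uv that by blast
      show "cmod (f (u(j := v, n := w))) \<le> M" if "v \<in> ball 0 (\<rho> j)" "w \<in> ball 0 R" for v w
        using lastbd uv that by blast
      show "(\<lambda>v. f (u(j := v, n := w))) holomorphic_on ball 0 (\<rho> j)" if w: "w \<in> ball 0 R" for w
        unfolding holomorphic_on_def
      proof
        fix v :: complex assume "v \<in> ball 0 (\<rho> j)"
        have twist: "u(j := v, n := w) = u(n := w, j := v)" for v
          using j by (simp add: fun_upd_twist)
        from \<open>v \<in> ball 0 (\<rho> j)\<close> have "u(n := w, j := v) \<in> polydisc (Suc n) \<rho>"
          using upd[OF uv w] by (simp add: twist)
        from Suc.prems(2)[unfolded holo_on_def, rule_format, OF this, of j] j
        show "(\<lambda>v. f (u(j := v, n := w))) field_differentiable at v within ball 0 (\<rho> j)"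
          unfolding twist by (simp add: field_differentiable_at_within)
      qed
    qed
    then have "(\<lambda>v. g k (u(j := v))) holomorphic_on ball 0 (\<rho> j)"
      by (rule holomorphic_transform) (use g uv in auto)
    then show "(\<lambda>w. g k (u(j := w))) field_differentiable at (u j)"
      by (rule holomorphic_on_imp_differentiable_at) (use u j in \<open>auto simp: polydisc_def\<close>)
  qed
  have coef: "partial_multi n \<alpha> (g k) = partial_multi (Suc n) (\<alpha>(n := k)) f" for \<alpha> k
    by (simp add: partial_multi_Suc g_def) (rule partial_multi_cong, simp)
  \<comment> \<open>For \<open>k \<ge> 2\<close> the exponent of the last variable alone puts the
    multi-index outside \<open>LambdaT (Suc n)\<close>.\<close>
  have vanish: "partial_multi n \<alpha> (g k) (\<lambda>_. 0) = 0" if "\<alpha> \<in> mindex n" "\<alpha> \<notin> LambdaT n \<or> k \<ge> 2" for \<alpha> k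
    unfolding coef
  proof (rule Suc.prems(4))
    show "\<alpha>(n := k) \<in> mindex (Suc n)" using that by (auto simp: mindex_def)
    show "\<alpha>(n := k) \<notin> LambdaT (Suc n)"
    proof
      assume *: "\<alpha>(n := k) \<in> LambdaT (Suc n)"
      then have "k \<le> 1" by (auto simp: LambdaT_def split: if_splits)
      moreover have "\<alpha> j \<le> 1" for j
        using * that(1) by (cases "j = n") (auto simp: LambdaT_def mindex_def split: if_splits)
      ultimately show False using that by (auto simp: LambdaT_def)
    qed
  qed
  have exp: "g k u = (\<Sum>S\<in>Pow {..<n}. partial_multi n (set_index S) (g k) (\<lambda>_. 0) * (\<Prod>i\<in>S. u i))"
    if "u \<in> polydisc n \<rho>" for u k
    using Suc.IH[OF _ g_holo g_bd _ that] Suc.prems(1) vanish by auto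
  define u where "u = z(n := 0)"
  have u: "u \<in> polydisc n \<rho>" using Suc.prems(5) by (auto simp: polydisc_def u_def cvec_def)
  have g0: "g k u = 0" if "k \<ge> 2" for k
    unfolding exp[OF u] using that
    by (intro sum.neutral ballI)
       (use set_index_in_LambdaT in \<open>force intro!: vanish simp: LambdaT_def\<close>)
  have zn: "z n \<in> ball 0 R" using Suc.prems(5) by (auto simp: polydisc_def R_def)
  have "(\<lambda>k. g k u / fact k * z n ^ k) sums f z"
    using holomorphic_power_series[OF last[OF u] zn] unfolding g[OF u] by (simp add: u_def)
  \<comment> \<open>Only degrees 0 and 1 in the last variable survive; they correspond to the
    subsets of \<open>{..<Suc n}\<close> without and with \<open>n\<close>.\<close>
  moreover have "(\<lambda>k. g k u / fact k * z n ^ k) sums (\<Sum>k\<in>{0,1}. g k u / fact k * z n ^ k)"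
    by (rule sums_finite) (auto intro!: g0 dest: le_SucI)
  ultimately have "f z = g 0 u + g 1 u * z n"
    by (auto dest: sums_unique2)
  also have "g 0 u = (\<Sum>S\<in>Pow {..<n}. partial_multi (Suc n) (set_index S) f (\<lambda>_. 0) * (\<Prod>i\<in>S. z i))"
    unfolding exp[OF u] coef
    by (intro sum.cong arg_cong2[where f = "(*)"] prod.cong arg_cong2[where f = "\<lambda>a. partial_multi (Suc n) a f"])
       (auto simp: u_def set_index_def fun_eq_iff)
  also have "g 1 u * z n = (\<Sum>S\<in>Pow {..<n}. partial_multi (Suc n) (set_index (insert n S)) f (\<lambda>_. 0) * (\<Prod>i\<in>insert n S. z i))"
    unfolding exp[OF u] coef sum_distrib_right
  proof (intro sum.cong refl)
    fix S assume S: "S \<in> Pow {..<n}"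
    then have "finite S" "n \<notin> S" using finite_subset by auto
    moreover have "(\<Prod>i\<in>S. u i) = (\<Prod>i\<in>S. z i)" using \<open>n \<notin> S\<close> by (intro prod.cong) (auto simp: u_def)
    moreover have "(set_index S)(n := 1) = set_index (insert n S)" by (auto simp: set_index_def)
    ultimately show "partial_multi (Suc n) ((set_index S)(n := 1)) f (\<lambda>_. 0) * (\<Prod>i\<in>S. u i) * z n
        = partial_multi (Suc n) (set_index (insert n S)) f (\<lambda>_. 0) * (\<Prod>i\<in>insert n S. z i)"
      by simp
  qed
  finally show ?case by (simp add: lessThan_Suc sum_Pow_insert)
qed

section \<open>Partial derivatives and Taylor coefficients of tetrahedral polynomials\<close>

lemma tetra_fun_upd: "k \<notin> V \<Longrightarrow> tetra V c (z(k := w)) = tetra V c z"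
  unfolding tetra_def by (intro sum.cong refl arg_cong2[where f = "(*)"] prod.cong) auto

lemma tetra_insert:
  assumes "finite V" "k \<notin> V"
  shows "tetra (insert k V) c z = tetra V c z + z k * tetra V (\<lambda>S. c (insert k S)) z"
proof -
  have "(\<Sum>S\<in>Pow V. c (insert k S) * (\<Prod>i\<in>insert k S. z i)) = z k * tetra V (\<lambda>S. c (insert k S)) z"
    unfolding tetra_def sum_distrib_left
  proof (rule sum.cong)
    fix S assume "S \<in> Pow V"
    then have "finite S" "k \<notin> S" using assms finite_subset by auto
    then show "c (insert k S) * (\<Prod>i\<in>insert k S. z i) = z k * (c (insert k S) * (\<Prod>i\<in>S. z i))"
      by (simp add: mult_ac)
  qed simp
  then show ?thesis using assms by (simp add: tetra_def sum_Pow_insert)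
qed

lemma tetra_remove:
  assumes "finite V" "k \<in> V"
  shows "tetra V c z = tetra (V - {k}) c z + z k * tetra (V - {k}) (\<lambda>S. c (insert k S)) z"
  using tetra_insert[of "V - {k}" k c z] assms by (simp add: insert_absorb)

lemma tetra_zero: "finite V \<Longrightarrow> tetra V c (\<lambda>_. 0) = c {}"
proof -
  assume V: "finite V"
  have "tetra V c (\<lambda>_. 0) = (\<Sum>S\<in>{{}}. c S * (\<Prod>i\<in>S. 0))"
    unfolding tetra_def
  proof (rule sum.mono_neutral_right)
    show "\<forall>S\<in>Pow V - {{}}. c S * (\<Prod>i\<in>S. 0) = 0"
    proof
      fix S assume "S \<in> Pow V - {{}}"
      then have "finite S" "S \<noteq> {}" using V finite_subset by auto
      then show "c S * (\<Prod>i\<in>S. 0) = 0" by (simp add: card_gt_0_iff)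
    qed
  qed (use V in auto)
  then show ?thesis by simp
qed

text \<open>The polynomial is affine in \<open>z k\<close>, so its derivative is the coefficient
  polynomial of that variable and is the same at every \<open>w\<close>.\<close>

lemma has_field_derivative_tetra:
  assumes "finite V"
  shows "((\<lambda>w. tetra V c (z(k := w))) has_field_derivative
           (if k \<in> V then tetra (V - {k}) (\<lambda>S. c (insert k S)) z else 0)) (at w)"
proof (cases "k \<in> V")
  case True
  have "(\<lambda>w. tetra V c (z(k := w))) =
        (\<lambda>w. tetra (V - {k}) c z + w * tetra (V - {k}) (\<lambda>S. c (insert k S)) z)"
    by (simp add: tetra_remove[OF assms True] tetra_fun_upd fun_eq_iff)
  then show ?thesis using True by (auto intro!: derivative_eq_intros)
qed (simp add: tetra_fun_upd)

lemma holo_on_tetra: "finite V \<Longrightarrow> holo_on n (tetra V c) U"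
  unfolding holo_on_def using has_field_derivative_tetra field_differentiable_def by blast

lemma partial_tetra:
  "finite V \<Longrightarrow> partial k (tetra V c) =
     (if k \<in> V then tetra (V - {k}) (\<lambda>S. c (insert k S)) else (\<lambda>_. 0))"
  unfolding partial_def by (rule ext) (simp add: DERIV_imp_deriv[OF has_field_derivative_tetra])

lemma partial_zero: "partial k (\<lambda>_. 0) = (\<lambda>_. 0)"
  by (simp add: partial_def)

lemma funpow_partial_zero: "(partial k ^^ j) (\<lambda>_. 0) = (\<lambda>_. 0)"
  by (induction j) (simp_all add: partial_zero)

lemma partial_multi_zero: "partial_multi n \<alpha> (\<lambda>_. 0) = (\<lambda>_. 0)"
  by (induction n) (simp_all add: partial_multi_Suc funpow_partial_zero, simp add: partial_multi_def)

text \<open>One derivative in a variable deletes it from \<open>V\<close> and adds it to the sets at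
  which \<open>c\<close> is read; a second derivative in the same variable gives zero.\<close>

lemma partial_multi_tetra:
  assumes "finite V"
  shows "partial_multi n \<alpha> (tetra V c) =
    (if (\<forall>k<n. \<alpha> k \<le> 1) \<and> {k. k < n \<and> \<alpha> k = 1} \<subseteq> V
     then tetra (V - {k. k < n \<and> \<alpha> k = 1}) (\<lambda>S. c (S \<union> {k. k < n \<and> \<alpha> k = 1}))
     else (\<lambda>_. 0))"
  using assms
proof (induction n arbitrary: V c)
  case 0
  then show ?case by (simp add: partial_multi_def)
next
  case (Suc n)
  consider "\<alpha> n = 0" | "\<alpha> n = 1" "n \<in> V" | "\<alpha> n = 1" "n \<notin> V" | j where "\<alpha> n = Suc (Suc j)"
    by (metis One_nat_def not0_implies_Suc)
  then show ?case
  proof cases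
    case 1
    then have T: "{k. k < Suc n \<and> \<alpha> k = 1} = {k. k < n \<and> \<alpha> k = 1}"
      by (auto simp: less_Suc_eq)
    have le: "(\<forall>k<Suc n. \<alpha> k \<le> 1) \<longleftrightarrow> (\<forall>k<n. \<alpha> k \<le> 1)" using 1 by (auto simp: less_Suc_eq)
    have "partial_multi (Suc n) \<alpha> (tetra V c) = partial_multi n \<alpha> (tetra V c)"
      using 1 by (simp add: partial_multi_Suc)
    then show ?thesis unfolding T le Suc.IH[OF Suc.prems] .
  next
    case 2
    let ?T = "{k. k < n \<and> \<alpha> k = 1}"
    have T: "{k. k < Suc n \<and> \<alpha> k = 1} = insert n ?T"
      using 2 by (auto simp: less_Suc_eq)
    have sub: "insert n ?T \<subseteq> V \<longleftrightarrow> ?T \<subseteq> V - {n}" using 2 by auto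
    have le: "(\<forall>k<Suc n. \<alpha> k \<le> 1) \<longleftrightarrow> (\<forall>k<n. \<alpha> k \<le> 1)" using 2 by (auto simp: less_Suc_eq)
    have d: "V - insert n ?T = V - {n} - ?T" by auto
    have "partial_multi (Suc n) \<alpha> (tetra V c) = partial_multi n \<alpha> (tetra (V - {n}) (\<lambda>S. c (insert n S)))"
      using 2 Suc.prems by (simp add: partial_multi_Suc partial_tetra)
    moreover have "finite (V - {n})" using Suc.prems by simp
    ultimately show ?thesis by (simp only: T sub le d Suc.IH Un_insert_right)
  next
    case 3
    then show ?thesis
      using Suc.prems by (auto simp: partial_multi_Suc partial_tetra partial_multi_zero)
  next
    case 4
    have "(partial n ^^ \<alpha> n) (tetra V c) = (partial n ^^ j) (partial n (partial n (tetra V c)))"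
      by (simp only: 4 funpow_Suc_right o_apply)
    also have "partial n (partial n (tetra V c)) = (\<lambda>_. 0)"
      using Suc.prems by (simp add: partial_tetra partial_zero)
    finally show ?thesis
      using 4 by (auto simp: partial_multi_Suc funpow_partial_zero partial_multi_zero)
  qed
qed

lemma prod_fact_set_index: "(\<Prod>k<n. fact (set_index S k) :: nat) = 1"
  by (rule prod.neutral) (auto simp: set_index_def)

lemma taylor_coeff_set_index: "taylor_coeff n (set_index S) f = partial_multi n (set_index S) f (\<lambda>_. 0)"
  unfolding taylor_coeff_def prod_fact_set_index by simp

text \<open>Allows test functions with prescribed coefficients to be inserted into the definition of
  the Bohr radius.\<close>

lemma taylor_coeff_tetra:
  assumes "S \<subseteq> {..<n}"
  shows "taylor_coeff n (set_index S) (tetra {..<n} c) = c S"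
proof -
  have "{k. k < n \<and> set_index S k = 1} = S" using assms by (auto simp: set_index_def)
  moreover have "\<forall>k<n. set_index S k \<le> 1" by (simp add: set_index_def)
  ultimately show ?thesis
    using assms by (simp add: taylor_coeff_set_index partial_multi_tetra tetra_zero)
qed

lemma taylor_coeff_tetra_eq_0:
  assumes "\<alpha> \<in> mindex n" "\<alpha> \<notin> LambdaT n"
  shows "taylor_coeff n \<alpha> (tetra {..<n} c) = 0"
proof -
  have "\<not> (\<forall>k<n. \<alpha> k \<le> 1)"
  proof
    assume *: "\<forall>k<n. \<alpha> k \<le> 1"
    have "\<alpha> k \<le> 1" for k using assms(1) * by (cases "k < n") (auto simp: mindex_def)
    then show False using assms by (auto simp: LambdaT_def)
  qed
  then show ?thesis unfolding taylor_coeff_def by (subst partial_multi_tetra) auto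
qed

lemma sum_LambdaT:
  "(\<Sum>\<alpha>\<in>LambdaT n. cmod (taylor_coeff n \<alpha> f * mpow n z \<alpha>)) =
   (\<Sum>S\<in>Pow {..<n}. cmod (taylor_coeff n (set_index S) f) * (\<Prod>i\<in>S. cmod (z i)))"
proof -
  have "(\<Sum>\<alpha>\<in>LambdaT n. cmod (taylor_coeff n \<alpha> f * mpow n z \<alpha>)) =
    (\<Sum>S\<in>Pow {..<n}. cmod (taylor_coeff n (set_index S) f * mpow n z (set_index S)))"
    by (rule sum.reindex_bij_betw[OF bij_betw_set_index, symmetric])
  also have "\<dots> = (\<Sum>S\<in>Pow {..<n}. cmod (taylor_coeff n (set_index S) f) * (\<Prod>i\<in>S. cmod (z i)))"
    by (rule sum.cong) (auto simp: mpow_set_index norm_mult prod_norm)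
  finally show ?thesis .
qed

section \<open>Symmetric sequence lattices\<close>

lemma bij_betw_add_mod: "bij_betw (\<lambda>i. (j + i) mod k) {..<k} {..<k::nat}"
proof -
  have "inj_on (\<lambda>i. (j + i) mod k) {..<k}"
  proof (rule linorder_inj_onI)
    fix a b assume ab: "a < b" "a \<in> {..<k}" "b \<in> {..<k}"
    show "(j + a) mod k \<noteq> (j + b) mod k"
    proof
      assume "(j + a) mod k = (j + b) mod k"
      then have "k dvd (j + b) - (j + a)" using ab by (metis mod_eq_dvd_iff_nat add_le_cancel_left less_imp_le)
      then show False using ab by (auto dest: dvd_imp_le)
    qed
  qed auto
  moreover from this have "(\<lambda>i. (j + i) mod k) ` {..<k} = {..<k}"
    by (intro endo_inj_surj) auto
  ultimately show ?thesis by (simp add: bij_betw_def)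
qed

locale symmetric_lattice =
  fixes Xs :: "(nat \<Rightarrow> complex) set" and nX :: "(nat \<Rightarrow> complex) \<Rightarrow> real"
  assumes lattice: "symmetric_banach_seq_lattice Xs nX"
begin

section \<open>Consequences of the lattice axioms\<close>

lemma zero_in: "(\<lambda>_. 0) \<in> Xs"
  and add_in: "x \<in> Xs \<Longrightarrow> y \<in> Xs \<Longrightarrow> (\<lambda>k. x k + y k) \<in> Xs"
  and scale_in: "x \<in> Xs \<Longrightarrow> (\<lambda>k. c * x k) \<in> Xs"
  and norm_nonneg: "x \<in> Xs \<Longrightarrow> 0 \<le> nX x"
  and norm_eq_0: "x \<in> Xs \<Longrightarrow> nX x = 0 \<longleftrightarrow> x = (\<lambda>_. 0)"
  and norm_scale: "x \<in> Xs \<Longrightarrow> nX (\<lambda>k. c * x k) = cmod c * nX x"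
  and norm_triangle: "x \<in> Xs \<Longrightarrow> y \<in> Xs \<Longrightarrow> nX (\<lambda>k. x k + y k) \<le> nX x + nX y"
  and ideal_in: "x \<in> Xs \<Longrightarrow> (\<And>k. cmod (y k) \<le> cmod (x k)) \<Longrightarrow> y \<in> Xs"
  and norm_mono: "x \<in> Xs \<Longrightarrow> (\<And>k. cmod (y k) \<le> cmod (x k)) \<Longrightarrow> nX y \<le> nX x"
  and perm_in: "bij \<sigma> \<Longrightarrow> x \<in> Xs \<Longrightarrow> (\<lambda>k. x (\<sigma> k)) \<in> Xs"
  and norm_perm: "bij \<sigma> \<Longrightarrow> x \<in> Xs \<Longrightarrow> nX (\<lambda>k. x (\<sigma> k)) = nX x"
  and unit_in: "unit_seq k \<in> Xs"
  using lattice unfolding symmetric_banach_seq_lattice_def o_def by blast+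

lemma cvec_in: "z \<in> cvec n \<Longrightarrow> z \<in> Xs"
proof (induction n arbitrary: z)
  case 0
  then have "z = (\<lambda>_. 0)" by (auto simp: cvec_def)
  then show ?case using zero_in by simp
next
  case (Suc n)
  have "z(n := 0) \<in> cvec n" using Suc.prems by (auto simp: cvec_def)
  from add_in[OF Suc.IH[OF this] scale_in[OF unit_in, of "z n" n]]
  show ?case by (rule back_subst[where P = "\<lambda>x. x \<in> Xs"]) (auto simp: unit_seq_def)
qed

lemma norm_zero: "nX (\<lambda>_. 0) = 0"
  using norm_eq_0[OF zero_in] by simp

lemma norm_abs_eq: "x \<in> Xs \<Longrightarrow> (\<And>k. cmod (y k) = cmod (x k)) \<Longrightarrow> nX y = nX x"
  by (intro antisym norm_mono) (auto intro: ideal_in)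

lemma normXn_eq: "z \<in> cvec n \<Longrightarrow> normXn nX n z = nX z"
  unfolding normXn_def by (rule norm_abs_eq) (auto intro: cvec_in simp: cvec_def)

lemma ballXn_eq: "ballXn nX n r = {z \<in> cvec n. nX z < r}"
  unfolding ballXn_def using normXn_eq by auto

lemma norm_sum_le:
  assumes "finite I" "\<And>i. i \<in> I \<Longrightarrow> x i \<in> Xs"
  shows "(\<lambda>k. \<Sum>i\<in>I. x i k) \<in> Xs \<and> nX (\<lambda>k. \<Sum>i\<in>I. x i k) \<le> (\<Sum>i\<in>I. nX (x i))"
  using assms
proof (induction I rule: finite_induct)
  case empty
  then show ?case by (simp add: zero_in norm_zero)
next
  case (insert i I)
  then have "(\<lambda>k. \<Sum>i\<in>I. x i k) \<in> Xs" "nX (\<lambda>k. \<Sum>i\<in>I. x i k) \<le> (\<Sum>i\<in>I. nX (x i))" "x i \<in> Xs" by auto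
  then show ?case using insert.hyps add_in[of "x i" "\<lambda>k. \<Sum>i\<in>I. x i k"]
      norm_triangle[of "x i" "\<lambda>k. \<Sum>i\<in>I. x i k"] by auto
qed

lemma norm_unit_pos: "0 < nX (unit_seq k)"
proof -
  have "unit_seq k \<noteq> (\<lambda>_. 0)" by (auto simp: unit_seq_def fun_eq_iff)
  then show ?thesis using norm_eq_0[OF unit_in] norm_nonneg[OF unit_in] by (metis less_eq_real_def)
qed

text \<open>The ideal property compares \<open>x\<close> with its single coordinate in position
  \<open>j\<close>. Hence norm-bounded sets have bounded coordinates, and the suprema in
  \<open>phi_dual\<close> and \<open>id_norm_lr\<close> are finite.\<close>

lemma coord_le: "x \<in> Xs \<Longrightarrow> cmod (x j) \<le> nX x / nX (unit_seq j)"
proof -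
  assume x: "x \<in> Xs"
  have "cmod (x j) * nX (unit_seq j) = nX (\<lambda>k. x j * unit_seq j k)"
    by (simp add: norm_scale unit_in)
  also have "\<dots> \<le> nX x" by (rule norm_mono[OF x]) (auto simp: unit_seq_def)
  finally show ?thesis using norm_unit_pos[of j] by (simp add: field_simps)
qed

lemma bdd_above_phi: "bdd_above ((\<lambda>x. \<Sum>j<k. cmod (x j)) ` {x \<in> Xs. nX x \<le> 1})"
proof (rule bdd_aboveI2)
  fix x assume "x \<in> {x \<in> Xs. nX x \<le> 1}"
  then have x: "x \<in> Xs" "nX x \<le> 1" by auto
  have "cmod (x j) \<le> 1 / nX (unit_seq j)" for j
    using coord_le[OF x(1), of j] x(2) norm_unit_pos[of j] by (meson divide_right_mono less_imp_le order_trans)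
  then show "(\<Sum>j<k. cmod (x j)) \<le> (\<Sum>j<k. 1 / nX (unit_seq j))" by (intro sum_mono)
qed

text \<open>Hoelder's inequality for \<open>X\<close> and its Koethe dual, tested on the indicator
  of \<open>{..<k}\<close>: normalise \<open>x\<close> and use the definition as a supremum.\<close>

lemma sum_le_phi_dual_norm:
  assumes x: "x \<in> Xs"
  shows "(\<Sum>j<k. cmod (x j)) \<le> phi_dual Xs nX k * nX x"
proof (cases "nX x = 0")
  case True
  then show ?thesis using norm_eq_0[OF x] by simp
next
  case False
  then have pos: "nX x > 0" using norm_nonneg[OF x] by simp
  define y where "y = (\<lambda>k. complex_of_real (1 / nX x) * x k)"
  have "y \<in> Xs" unfolding y_def by (rule scale_in[OF x])
  moreover have "nX y = 1"
    unfolding y_def norm_scale[OF x] using pos by (simp add: norm_divide)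
  ultimately have "(\<Sum>j<k. cmod (y j)) \<le> phi_dual Xs nX k"
    unfolding phi_dual_def by (intro cSUP_upper bdd_above_phi) auto
  moreover have "(\<Sum>j<k. cmod (y j)) = (\<Sum>j<k. cmod (x j)) / nX x"
    using pos by (simp add: y_def norm_mult norm_divide sum_divide_distrib)
  ultimately show ?thesis using pos by (simp add: field_simps)
qed

lemma phi_dual_nonneg: "0 \<le> phi_dual Xs nX k"
proof -
  have "0 \<le> (\<Sum>j<k. cmod (unit_seq 0 j))" by (simp add: sum_nonneg)
  also have "\<dots> \<le> phi_dual Xs nX k * nX (unit_seq 0)" by (rule sum_le_phi_dual_norm[OF unit_in])
  finally show ?thesis using norm_unit_pos[of 0] by (simp add: zero_le_mult_iff)
qed

lemma phi_dual_pos: "1 \<le> k \<Longrightarrow> 0 < phi_dual Xs nX k"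
proof -
  assume k: "1 \<le> k"
  have "(1::real) = cmod (unit_seq 0 0)" by (simp add: unit_seq_def)
  also have "\<dots> \<le> (\<Sum>j<k. cmod (unit_seq 0 j))" by (rule member_le_sum) (use k in auto)
  also have "\<dots> \<le> phi_dual Xs nX k * nX (unit_seq 0)" by (rule sum_le_phi_dual_norm[OF unit_in])
  finally show ?thesis using norm_unit_pos[of 0] by (metis less_le_trans zero_less_mult_pos2 zero_less_one)
qed

section \<open>The fundamental function of \<open>X\<close> and its relation to that of the
  dual\<close>

definition phi :: "nat \<Rightarrow> real" where
  "phi k = nX (\<lambda>j. if j < k then 1 else 0)"

lemma ones_in: "(\<lambda>j. if j < k then 1 else 0) \<in> Xs"
  by (rule cvec_in[of _ k]) (simp add: cvec_def)

lemma phi_nonneg: "0 \<le> phi k"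
  unfolding phi_def by (rule norm_nonneg[OF ones_in])

lemma phi_pos: "1 \<le> k \<Longrightarrow> 0 < phi k"
proof -
  assume k: "1 \<le> k"
  have "nX (unit_seq 0) \<le> phi k"
    unfolding phi_def by (rule norm_mono[OF ones_in]) (use k in \<open>auto simp: unit_seq_def\<close>)
  then show ?thesis using norm_unit_pos[of 0] by simp
qed

text \<open>Averaging over the cyclic permutations of the first \<open>k\<close> coordinates.\<close>

lemma phi_dual_phi_le: "phi_dual Xs nX k * phi k \<le> real k"
proof (cases "k = 0")
  case True
  then show ?thesis by (simp add: phi_def norm_zero)
next
  case False
  have "(\<Sum>j<k. cmod (x j)) \<le> real k / phi k" if x: "x \<in> Xs" "nX x \<le> 1" for x
  proof -
    define s where "s = (\<Sum>j<k. cmod (x j))"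
    define y where "y = (\<lambda>j. if j < k then complex_of_real (cmod (x j)) else 0)"
    define \<sigma> where "\<sigma> i = (\<lambda>j. if j < k then (i + j) mod k else j)" for i
    have yx: "cmod (y j) \<le> cmod (x j)" for j by (simp add: y_def)
    have y: "y \<in> Xs" "nX y \<le> 1"
      using ideal_in[OF x(1) yx] norm_mono[OF x(1) yx] x(2) by auto
    have "bij (\<sigma> i)" for i
    proof -
      have "bij_betw (\<sigma> i) {..<k} {..<k}"
        using bij_betw_add_mod[of i k] by (rule bij_betw_cong[THEN iffD1, rotated]) (simp add: \<sigma>_def)
      then have "\<sigma> i permutes {..<k}" by (rule bij_imp_permutes) (simp add: \<sigma>_def)
      then show ?thesis by (rule permutes_bij)
    qed
    then have ys: "(\<lambda>j. y (\<sigma> i j)) \<in> Xs" "nX (\<lambda>j. y (\<sigma> i j)) = nX y" for i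
      using y perm_in norm_perm by auto
    \<comment> \<open>Over the \<open>k\<close> shifts every coordinate below \<open>k\<close> meets
      each \<open>y i\<close> exactly once, so the shifted copies sum to a multiple of the
      indicator.\<close>
    have eq: "(\<Sum>i<k. y (\<sigma> i j)) = of_real s * (if j < k then 1 else 0)" for j
    proof (cases "j < k")
      case True
      have "(\<Sum>i<k. y (\<sigma> i j)) = (\<Sum>i<k. y ((j + i) mod k))"
        using True by (simp add: \<sigma>_def add.commute)
      also have "\<dots> = (\<Sum>i<k. y i)" by (rule sum.reindex_bij_betw[OF bij_betw_add_mod])
      finally show ?thesis using True by (simp add: y_def s_def)
    qed (simp add: \<sigma>_def y_def)
    have s0: "s \<ge> 0" by (simp add: s_def sum_nonneg)
    have "s * phi k = nX (\<lambda>j. of_real s * (if j < k then 1 else 0))"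
      using norm_scale[OF ones_in, of "of_real s" k] s0 by (simp add: phi_def)
    also have "\<dots> = nX (\<lambda>j. \<Sum>i<k. y (\<sigma> i j))" by (simp add: eq)
    also have "\<dots> \<le> (\<Sum>i<k. nX (\<lambda>j. y (\<sigma> i j)))" using norm_sum_le[of "{..<k}" "\<lambda>i j. y (\<sigma> i j)"] ys by auto
    also have "\<dots> \<le> real k" using y ys by (simp add: mult_left_le)
    finally show ?thesis using phi_pos[of k] False by (simp add: s_def field_simps)
  qed
  then have "phi_dual Xs nX k \<le> real k / phi k"
    unfolding phi_dual_def by (intro cSUP_least) (use zero_in norm_zero in force)+
  then show ?thesis using phi_pos[of k] False by (simp add: field_simps)
qed

text \<open>Symmetry speaks of bijections of all of \<open>nat\<close>: a bijection from
  \<open>T\<close> onto \<open>{..<card T}\<close> is completed by matching the complements within a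
  common \<open>{..<N}\<close> and by the identity from \<open>N\<close> on.\<close>

lemma norm_indicator:
  assumes "finite T"
  shows "nX (\<lambda>j. if j \<in> T then 1 else 0) = phi (card T)"
proof -
  obtain N where N: "T \<subseteq> {..<N}" using assms finite_nat_iff_bounded by auto
  have c: "card T \<le> N" using card_mono[OF _ N] by simp
  obtain p where p: "bij_betw p T {..<card T}"
    using finite_same_card_bij[OF assms, of "{..<card T}"] by auto
  obtain q where q: "bij_betw q ({..<N} - T) {card T..<N}"
    using finite_same_card_bij[of "{..<N} - T" "{card T..<N}"] N assms by (auto simp: card_Diff_subset)
  define \<sigma> where "\<sigma> j = (if j \<in> T then p j else if j < N then q j else j)" for j
  have "bij_betw \<sigma> T {..<card T}" using p by (rule bij_betw_cong[THEN iffD1, rotated]) (simp add: \<sigma>_def)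
  moreover have "bij_betw \<sigma> ({..<N} - T) {card T..<N}"
    using q by (rule bij_betw_cong[THEN iffD1, rotated]) (simp add: \<sigma>_def)
  ultimately have "bij_betw \<sigma> (T \<union> ({..<N} - T)) ({..<card T} \<union> {card T..<N})"
    by (rule bij_betw_combine) auto
  moreover have "T \<union> ({..<N} - T) = {..<N}" "{..<card T} \<union> {card T..<N} = {..<N}"
    using N c by auto
  ultimately have "bij_betw \<sigma> {..<N} {..<N}" by simp
  then have "\<sigma> permutes {..<N}" by (rule bij_imp_permutes) (use N in \<open>auto simp: \<sigma>_def\<close>)
  then have "bij \<sigma>" by (rule permutes_bij)
  have iff: "\<sigma> j < card T \<longleftrightarrow> j \<in> T" for j
    using bij_betw_apply[OF p, of j] bij_betw_apply[OF q, of j] c by (auto simp: \<sigma>_def)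
  show ?thesis
    using norm_perm[OF \<open>bij \<sigma>\<close> ones_in, of "card T"] by (simp add: iff phi_def)
qed

text \<open>Adding \<delta> to the \<open>n\<close> moduli of \<open>z\<close> raises the norm by at
  most \<open>\<delta> * phi n\<close>; the ideal property then covers the whole polydisc with these
  radii.\<close>

lemma polydisc_in_ball:
  assumes z: "z \<in> ballXn nX n 1"
  obtains \<rho> where "\<And>i. 0 < \<rho> i" "z \<in> polydisc n \<rho>" "polydisc n \<rho> \<subseteq> ballXn nX n 1"
proof -
  have zc: "z \<in> cvec n" and z1: "nX z < 1" using z by (auto simp: ballXn_eq)
  \<comment> \<open>The summand 1 makes \<open>\<delta> * phi n < 1 - nX z\<close> strict and keeps
    the quotient meaningful for \<open>n = 0\<close>, where \<open>phi n = 0\<close>.\<close>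
  define \<delta> where "\<delta> = (1 - nX z) / (1 + phi n)"
  have d: "\<delta> > 0" "\<delta> * phi n < 1 - nX z"
    using z1 phi_nonneg[of n] by (auto simp: \<delta>_def field_simps)
  define x where "x = (\<lambda>j. complex_of_real (cmod (z j)) + of_real \<delta> * (if j < n then 1 else 0))"
  have az: "(\<lambda>j. complex_of_real (cmod (z j))) \<in> Xs" "nX (\<lambda>j. complex_of_real (cmod (z j))) = nX z"
    using zc by (auto intro!: ideal_in[OF cvec_in[OF zc]] norm_abs_eq[OF cvec_in[OF zc]])
  have x: "x \<in> Xs" "nX x \<le> nX z + \<delta> * phi n"
    using add_in[OF az(1) scale_in[OF ones_in]] norm_triangle[OF az(1) scale_in[OF ones_in], of "of_real \<delta>" n]
      norm_scale[OF ones_in, of "of_real \<delta>" n] d az(2)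
    by (auto simp: x_def phi_def)
  show thesis
  proof
    show "0 < cmod (z i) + \<delta>" for i using d by (simp add: add_nonneg_pos)
    show "z \<in> polydisc n (\<lambda>i. cmod (z i) + \<delta>)" using zc d by (simp add: polydisc_def)
    show "polydisc n (\<lambda>i. cmod (z i) + \<delta>) \<subseteq> ballXn nX n 1"
    proof
      fix w assume w: "w \<in> polydisc n (\<lambda>i. cmod (z i) + \<delta>)"
      have "cmod (w j) \<le> cmod (x j)" for j
      proof (cases "j < n")
        case True
        then have "cmod (w j) < cmod (z j) + \<delta>" using w by (auto simp: polydisc_def)
        also have "\<dots> = cmod (x j)" using True d
          by (simp add: x_def flip: of_real_add)
        finally show ?thesis by simp
      qed (use w in \<open>auto simp: polydisc_def cvec_def\<close>)
      then have "nX w \<le> nX x" by (rule norm_mono[OF x(1)])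
      then show "w \<in> ballXn nX n 1" using w x d by (auto simp: ballXn_eq polydisc_def)
    qed
  qed
qed

text \<open>Every point of the ball lies in a polydisc around 0 inside the ball; the coefficients
  are derivatives of \<open>f\<close> at 0 and thus the same for all these polydiscs.\<close>

lemma ball_expansion:
  assumes "holo_on n f (ballXn nX n 1)" "\<And>z. z \<in> ballXn nX n 1 \<Longrightarrow> cmod (f z) \<le> M"
    and "\<And>\<alpha>. \<alpha> \<in> mindex n \<Longrightarrow> \<alpha> \<notin> LambdaT n \<Longrightarrow> taylor_coeff n \<alpha> f = 0"
    and z: "z \<in> ballXn nX n 1"
  shows "f z = tetra {..<n} (\<lambda>S. taylor_coeff n (set_index S) f) z"
proof -
  from polydisc_in_ball[OF z] obtain \<rho> where
    \<rho>: "\<And>i. 0 < \<rho> i" "z \<in> polydisc n \<rho>" "polydisc n \<rho> \<subseteq> ballXn nX n 1" by metis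
  have "partial_multi n \<alpha> f (\<lambda>_. 0) = 0" if "\<alpha> \<in> mindex n" "\<alpha> \<notin> LambdaT n" for \<alpha>
  proof -
    have "(\<Prod>k<n. fact (\<alpha> k)) \<noteq> (0::nat)" by simp
    then show ?thesis using assms(3)[OF that] unfolding taylor_coeff_def by (metis divide_eq_0_iff of_nat_eq_0_iff)
  qed
  moreover have "holo_on n f (polydisc n \<rho>)" using assms(1) \<rho>(3) by (auto simp: holo_on_def)
  ultimately show ?thesis
    unfolding taylor_coeff_set_index
    using multiaffine_expansion[of n \<rho> f M z] \<rho> assms(2) by blast
qed

end

section \<open>Elementary symmetric sums and coefficient estimates\<close>

definition subsets_card :: "'a set \<Rightarrow> nat \<Rightarrow> 'a set set" where
  "subsets_card V k = {S. S \<subseteq> V \<and> card S = k}"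

lemma finite_subsets_card: "finite V \<Longrightarrow> finite (subsets_card V k)"
  by (rule finite_subset[of _ "Pow V"]) (auto simp: subsets_card_def)

lemma subsets_card_0: "finite V \<Longrightarrow> subsets_card V 0 = {{}}"
  by (auto simp: subsets_card_def dest: finite_subset)

lemma card_subsets_card: "finite V \<Longrightarrow> card (subsets_card V k) = card V choose k"
  by (simp add: subsets_card_def n_subsets)

text \<open>Pascal's recursion: split the sets by membership of \<open>a\<close>.\<close>

lemma sum_subsets_card_insert:
  fixes g :: "'a set \<Rightarrow> 'b::comm_monoid_add"
  assumes "finite V" "a \<notin> V"
  shows "(\<Sum>S\<in>subsets_card (insert a V) (Suc j). g S) =
         (\<Sum>S\<in>subsets_card V (Suc j). g S) + (\<Sum>S\<in>subsets_card V j. g (insert a S))"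
proof -
  have eq: "subsets_card (insert a V) (Suc j) = subsets_card V (Suc j) \<union> insert a ` subsets_card V j"
  proof (intro set_eqI iffI)
    fix S assume S: "S \<in> subsets_card (insert a V) (Suc j)"
    show "S \<in> subsets_card V (Suc j) \<union> insert a ` subsets_card V j"
    proof (cases "a \<in> S")
      case True
      then have "S = insert a (S - {a})" "S - {a} \<in> subsets_card V j"
        using S by (auto simp: subsets_card_def)
      then show ?thesis by blast
    qed (use S in \<open>auto simp: subsets_card_def\<close>)
  next
    fix S assume S: "S \<in> subsets_card V (Suc j) \<union> insert a ` subsets_card V j"
    have "card (insert a T) = Suc j" if "T \<subseteq> V" "card T = j" for T
      using that assms finite_subset[OF that(1)] by (subst card_insert_disjoint) auto
    then show "S \<in> subsets_card (insert a V) (Suc j)" using S by (auto simp: subsets_card_def)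
  qed
  have inj: "inj_on (insert a) (subsets_card V j)"
    using assms by (auto simp: inj_on_def subsets_card_def)
  have disj: "subsets_card V (Suc j) \<inter> insert a ` subsets_card V j = {}"
    using assms by (auto simp: subsets_card_def)
  show ?thesis
    unfolding eq
    by (subst sum.union_disjoint) (use assms inj disj in \<open>auto simp: finite_subsets_card sum.reindex\<close>)
qed

lemma power_add_ge_two_terms:
  fixes s x :: real
  assumes "0 \<le> s" "0 \<le> x"
  shows "s ^ Suc j + real (Suc j) * x * s ^ j \<le> (s + x) ^ Suc j"
proof (induction j)
  case (Suc j)
  have "s ^ Suc (Suc j) + real (Suc (Suc j)) * x * s ^ Suc j
      \<le> (s + x) * (s ^ Suc j + real (Suc j) * x * s ^ j)"
    using assms by (simp add: algebra_simps)
  also have "\<dots> \<le> (s + x) * (s + x) ^ Suc j"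
    using assms by (intro mult_left_mono Suc.IH) auto
  finally show ?case by simp
qed simp

text \<open>Expanding the \<open>k\<close>-th power produces every squarefree monomial
  \<open>k!\<close> times and otherwise nonnegative terms; the induction on \<open>V\<close> obtains
  this from two terms of the binomial expansion.\<close>

lemma sum_prod_subsets_card_le:
  fixes x :: "'a \<Rightarrow> real"
  assumes "finite V" "\<And>i. i \<in> V \<Longrightarrow> 0 \<le> x i"
  shows "(\<Sum>S\<in>subsets_card V k. \<Prod>i\<in>S. x i) \<le> (\<Sum>i\<in>V. x i) ^ k / fact k"
  using assms
proof (induction V arbitrary: k rule: finite_induct)
  case empty
  show ?case
  proof (cases k)
    case 0
    then show ?thesis by (simp add: subsets_card_0)
  next
    case (Suc j)
    then have "subsets_card {} k = ({} :: 'a set set)" by (auto simp: subsets_card_def)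
    then show ?thesis by (simp add: Suc)
  qed
next
  case (insert a V)
  show ?case
  proof (cases k)
    case 0
    then show ?thesis using insert.hyps by (simp add: subsets_card_0)
  next
    case (Suc j)
    define s where "s = (\<Sum>i\<in>V. x i)"
    have s: "0 \<le> s" "0 \<le> x a" using insert.prems by (auto simp: s_def intro: sum_nonneg)
    have IH: "(\<Sum>S\<in>subsets_card V k. \<Prod>i\<in>S. x i) \<le> s ^ k / fact k" for k
      unfolding s_def using insert.IH insert.prems by blast
    have "(\<Sum>S\<in>subsets_card V j. \<Prod>i\<in>insert a S. x i) = x a * (\<Sum>S\<in>subsets_card V j. \<Prod>i\<in>S. x i)"
      unfolding sum_distrib_left
    proof (rule sum.cong)
      fix S assume "S \<in> subsets_card V j"
      then have "finite S" "a \<notin> S" using insert.hyps finite_subset by (auto simp: subsets_card_def)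
      then show "(\<Prod>i\<in>insert a S. x i) = x a * (\<Prod>i\<in>S. x i)" by simp
    qed simp
    then have "(\<Sum>S\<in>subsets_card (insert a V) k. \<Prod>i\<in>S. x i)
        = (\<Sum>S\<in>subsets_card V (Suc j). \<Prod>i\<in>S. x i) + x a * (\<Sum>S\<in>subsets_card V j. \<Prod>i\<in>S. x i)"
      using insert.hyps by (simp add: Suc sum_subsets_card_insert)
    also have "\<dots> \<le> s ^ Suc j / fact (Suc j) + x a * (s ^ j / fact j)"
      using s by (intro add_mono mult_left_mono IH)
    also have "\<dots> = (s ^ Suc j + real (Suc j) * x a * s ^ j) / fact (Suc j)"
      by (simp add: add_divide_distrib fact_Suc del: of_nat_Suc)
    also have "\<dots> \<le> (s + x a) ^ Suc j / fact (Suc j)"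
      using power_add_ge_two_terms[OF s] by (intro divide_right_mono) auto
    finally show ?thesis using insert.hyps by (simp add: Suc s_def add.commute)
  qed
qed

text \<open>Double counting: a set with a marked element \<open>k\<close> is the same as a set
  \<open>T\<close> one smaller together with some \<open>k\<close> outside it.\<close>

lemma sum_subsets_card_pairs:
  fixes g :: "'a set \<Rightarrow> 'a \<Rightarrow> 'b::comm_monoid_add"
  assumes "finite V"
  shows "(\<Sum>S\<in>subsets_card V (Suc j). \<Sum>k\<in>S. g S k) =
         (\<Sum>T\<in>subsets_card V j. \<Sum>k\<in>V - T. g (insert k T) k)"
proof -
  have fin: "finite S" if "S \<in> subsets_card V k" for S k
    using that assms finite_subset by (auto simp: subsets_card_def)
  have remove: "S - {k} \<in> subsets_card V j" if "S \<in> subsets_card V (Suc j)" "k \<in> S" for S k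
    using that by (auto simp: subsets_card_def)
  have insert_in: "insert k T \<in> subsets_card V (Suc j)" if "T \<in> subsets_card V j" "k \<in> V" "k \<notin> T" for T k
    using that fin[OF that(1)] by (auto simp: subsets_card_def)
  have subs: "k \<in> V" if "S \<in> subsets_card V (Suc j)" "k \<in> S" for S k
    using that by (auto simp: subsets_card_def)
  have "(\<Sum>S\<in>subsets_card V (Suc j). \<Sum>k\<in>S. g S k) =
        (\<Sum>(S, k)\<in>Sigma (subsets_card V (Suc j)) (\<lambda>S. S). g S k)"
    using assms fin by (intro sum.Sigma) (auto simp: finite_subsets_card)
  also have "\<dots> = (\<Sum>(T, k)\<in>Sigma (subsets_card V j) (\<lambda>T. V - T). g (insert k T) k)"
    by (rule sum.reindex_bij_witness[where j = "\<lambda>(S, k). (S - {k}, k)" and i = "\<lambda>(T, k). (insert k T, k)"])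
       (auto simp: insert_absorb remove insert_in dest: subs)
  also have "\<dots> = (\<Sum>T\<in>subsets_card V j. \<Sum>k\<in>V - T. g (insert k T) k)"
    using assms by (intro sum.Sigma[symmetric]) (auto simp: finite_subsets_card)
  finally show ?thesis .
qed

lemma sum_Pow_by_card:
  fixes g :: "'a set \<Rightarrow> 'b::comm_monoid_add"
  assumes "finite V"
  shows "(\<Sum>S\<in>Pow V. g S) = (\<Sum>k\<le>card V. \<Sum>S\<in>subsets_card V k. g S)"
proof -
  have "(\<Sum>S\<in>Pow V. g S) = (\<Sum>k\<in>{..card V}. sum g {S \<in> Pow V. card S = k})"
    using assms by (intro sum.group[symmetric]) (auto simp: card_mono)
  moreover have "{S \<in> Pow V. card S = k} = subsets_card V k" for k by (auto simp: subsets_card_def)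
  ultimately show ?thesis by simp
qed

section \<open>Exponential bounds and coefficients of bounded polynomials\<close>

lemma sum_power_div_fact_le_exp:
  fixes x :: real
  assumes "0 \<le> x" "finite A"
  shows "(\<Sum>k\<in>A. x ^ k / fact k) \<le> exp x"
proof -
  have s: "(\<lambda>n. x ^ n / fact n) sums exp x"
    using exp_converges[of x] by (simp add: field_simps)
  have "(\<Sum>k\<in>A. x ^ k / fact k) \<le> (\<Sum>n. x ^ n / fact n)"
    by (rule sum_le_suminf) (use s assms in \<open>auto simp: sums_iff\<close>)
  then show ?thesis using s by (simp add: sums_iff)
qed

lemma power_div_fact_le_exp: "0 \<le> x \<Longrightarrow> x ^ k / fact k \<le> exp (x::real)"
  using sum_power_div_fact_le_exp[of x "{k}"] by simp

text \<open>The term of index \<open>k\<close> in the series of \<open>exp k\<close> is at most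
  \<open>exp k\<close>, and 3 replaces \<open>exp 1\<close>.\<close>

lemma self_power_le_fact: "real k ^ k \<le> 3 ^ k * fact k"
proof -
  have "real k ^ k / fact k \<le> exp (real k * 1)" using power_div_fact_le_exp[of "real k" k] by simp
  also have "\<dots> = exp 1 ^ k" by (simp only: exp_of_nat_mult)
  also have "\<dots> \<le> 3 ^ k" by (intro power_mono exp_le) auto
  finally show ?thesis by (simp add: field_simps)
qed

lemma sum_cis_eq_0:
  assumes "0 < N" "k \<noteq> 0" "\<bar>k\<bar> < int N"
  shows "(\<Sum>j<N. cis (2 * pi * of_int k * real j / real N)) = 0"
proof -
  define \<omega> where "\<omega> = cis (2 * pi * of_int k / real N)"
  have "\<omega> \<noteq> 1"
  proof
    assume "\<omega> = 1"
    then have "cos (2 * pi * of_int k / real N) = 1" by (simp add: \<omega>_def complex_eq_iff)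
    then obtain i :: int where "2 * pi * of_int k / real N = of_int i * 2 * pi"
      using cos_one_2pi_int by auto
    then have "real_of_int k = of_int i * real N" using assms(1) by (simp add: field_simps)
    then have "k = i * int N" by (metis of_int_eq_iff of_int_mult of_int_of_nat_eq)
    then show False using assms by (auto simp: abs_mult)
  qed
  have pw: "cis (2 * pi * of_int k * real j / real N) = \<omega> ^ j" for j
    unfolding \<omega>_def Complex.DeMoivre by (rule arg_cong[where f = cis]) simp
  have "\<omega> ^ N = cis (2 * pi * of_int k)"
    unfolding \<omega>_def Complex.DeMoivre using assms(1) by (intro arg_cong[where f = cis]) simp
  also have "\<dots> = 1" by (intro cis_multiple_2pi) auto
  finally show ?thesis
    unfolding pw using \<open>\<omega> \<noteq> 1\<close> by (simp add: sum_gp_strict)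
qed

text \<open>Caratheodory's coefficient estimate, obtained by pairing the nonnegative function
  \<open>M - Re (\<gamma> p)\<close> with a character; averaging over roots of unity of order greater than \<open>2 n\<close>
  replaces integration over the circle.\<close>

lemma coeff_le_of_bounded_on_circle:
  fixes p :: "nat \<Rightarrow> complex"
  assumes bd: "\<And>\<zeta>. cmod \<zeta> = 1 \<Longrightarrow> cmod (\<Sum>k\<le>n. \<zeta> ^ k * p k) \<le> M"
    and m: "1 \<le> m" "m \<le> n"
  shows "cmod (p m) \<le> 2 * (M - cmod (p 0))"
proof -
  \<comment> \<open>All frequencies \<open>int k + a\<close> below have modulus at most
    \<open>2 * n\<close>, so those different from 0 are not multiples of \<open>N\<close>.\<close>
  define N where "N = 2 * n + 1"
  have N: "0 < N" by (simp add: N_def)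
  define e where "e k j = cis (2 * pi * of_int k * real j / real N)" for k j
  have e_mult: "e a j * e b j = e (a + b) j" for a b j
    by (simp add: e_def cis_mult add_divide_distrib algebra_simps)
  have e_norm: "cmod (e a j) = 1" for a j by (simp add: e_def)
  have e_cnj: "cnj (e a j) = e (- a) j" for a j by (simp add: e_def cis_cnj)
  have e_pow: "e 1 j ^ k = e (int k) j" for k j
    unfolding e_def Complex.DeMoivre by (rule arg_cong[where f = cis]) simp
  have e_sum: "(\<Sum>j<N. e k j) = (if k = 0 then of_nat N else 0)" if "\<bar>k\<bar> < int N" for k
    using sum_cis_eq_0[OF N _ that] by (simp add: e_def)
  \<comment> \<open>Rotating by \<gamma> makes the constant term the nonnegative number
    \<open>cmod (p 0)\<close>, so that \<open>h\<close> has mean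
    \<open>M - cmod (p 0)\<close>.\<close>
  obtain \<gamma> where \<gamma>: "cmod \<gamma> = 1" "\<gamma> * p 0 = of_real (cmod (p 0))"
  proof (cases "p 0 = 0")
    case True
    then show ?thesis using that[of 1] by simp
  next
    case False
    have "cnj (sgn (p 0)) * p 0 = of_real (cmod (p 0))"
      using False complex_norm_square[of "p 0"]
      by (simp add: sgn_div_norm scaleR_conv_of_real power2_eq_square field_simps)
    then show ?thesis using that[of "cnj (sgn (p 0))"] False by (simp add: norm_sgn)
  qed
  define q where "q j = \<gamma> * (\<Sum>k\<le>n. e (int k) j * p k)" for j
  define h where "h j = M - Re (q j)" for j
  have h: "0 \<le> h j" for j
  proof -
    have "Re (q j) \<le> cmod (q j)" by (rule complex_Re_le_cmod)
    also have "\<dots> \<le> M" using bd[OF e_norm[of 1 j]] \<gamma>(1) by (simp add: q_def norm_mult e_pow)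
    finally show ?thesis by (simp add: h_def)
  qed
  have corr: "(\<Sum>j<N. q j * e a j) = \<gamma> * (\<Sum>k\<le>n. if int k + a = 0 then of_nat N * p k else 0)"
    if "\<bar>a\<bar> \<le> int n" for a
  proof -
    have "(\<Sum>j<N. q j * e a j) = (\<Sum>j<N. \<Sum>k\<le>n. \<gamma> * (p k * e (int k + a) j))"
      by (simp add: q_def sum_distrib_left sum_distrib_right e_mult[symmetric] mult_ac)
    also have "\<dots> = (\<Sum>k\<le>n. \<gamma> * (p k * (\<Sum>j<N. e (int k + a) j)))"
      by (subst sum.swap) (simp add: sum_distrib_left)
    also have "\<dots> = (\<Sum>k\<le>n. \<gamma> * (if int k + a = 0 then of_nat N * p k else 0))"
    proof (intro sum.cong refl)
      fix k assume "k \<in> {..n}"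
      then have "\<bar>int k + a\<bar> < int N" using that by (auto simp: N_def)
      then show "\<gamma> * (p k * (\<Sum>j<N. e (int k + a) j)) = \<gamma> * (if int k + a = 0 then of_nat N * p k else 0)"
        by (simp add: e_sum)
    qed
    finally show ?thesis by (simp add: sum_distrib_left)
  qed
  have q0: "(\<Sum>j<N. q j) = of_nat N * of_real (cmod (p 0))"
  proof -
    have "(\<Sum>k\<le>n. if int k + 0 = 0 then of_nat N * p k else 0) = of_nat N * p 0"
      by (simp add: sum.delta)
    then show ?thesis using corr[of 0] \<gamma>(2) by (simp add: e_def mult_ac)
  qed
  have h0: "(\<Sum>j<N. h j) = real N * (M - cmod (p 0))"
  proof -
    have "(\<Sum>j<N. Re (q j)) = Re (of_nat N * of_real (cmod (p 0)))" by (simp only: q0 flip: Re_sum)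
    then show ?thesis by (simp add: h_def sum_subtractf algebra_simps)
  qed
  \<comment> \<open>In \<open>Re (q j)\<close> the half of \<open>q\<close> contributes
    \<open>p m\<close>, while the conjugate half and the constant \<open>M\<close> have no matching
    frequency; hence the factor 2 in the estimate.\<close>
  have h1: "(\<Sum>j<N. of_real (h j) * e (- int m) j) = - (of_nat N / 2) * (\<gamma> * p m)"
  proof -
    have hj: "of_real (h j) * e (- int m) j
        = of_real M * e (- int m) j - (q j * e (- int m) j + cnj (q j * e (int m) j)) / 2" for j
    proof -
      have "complex_of_real (Re (q j)) = (q j + cnj (q j)) / 2" by (simp add: complex_add_cnj)
      then show ?thesis by (simp add: h_def e_cnj algebra_simps add_divide_distrib)
    qed
    have "(\<Sum>k\<le>n. if int k + - int m = 0 then of_nat N * p k else 0)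
        = (\<Sum>k\<le>n. if k = m then of_nat N * p k else 0)" by (intro sum.cong) auto
    then have s1: "(\<Sum>j<N. q j * e (- int m) j) = \<gamma> * (of_nat N * p m)"
      using m corr[of "- int m"] by simp
    have "(\<Sum>k\<le>n. if int k + int m = 0 then of_nat N * p k else 0) = 0"
      using m by (intro sum.neutral) auto
    then have s2: "(\<Sum>j<N. q j * e (int m) j) = 0" using m corr[of "int m"] by simp
    have s3: "(\<Sum>j<N. e (- int m) j) = 0" 
      using m e_sum[of "- int m"] by (simp add: N_def del: sum.lessThan_Suc)
    have "(\<Sum>j<N. of_real (h j) * e (- int m) j)
        = of_real M * (\<Sum>j<N. e (- int m) j)
          - ((\<Sum>j<N. q j * e (- int m) j) + cnj (\<Sum>j<N. q j * e (int m) j)) / 2"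
      unfolding hj sum_subtractf sum_divide_distrib[symmetric] sum.distrib cnj_sum sum_distrib_left ..
    then show ?thesis by (simp add: s1 s2 s3)
  qed
  have "real N / 2 * cmod (p m) = cmod (\<Sum>j<N. of_real (h j) * e (- int m) j)"
    by (simp add: h1 norm_mult norm_divide \<gamma>(1))
  also have "\<dots> \<le> (\<Sum>j<N. cmod (of_real (h j) * e (- int m) j))" by (rule norm_sum)
  also have "\<dots> = (\<Sum>j<N. h j)" using h by (simp add: norm_mult e_norm)
  finally have "real N * cmod (p m) \<le> real N * (2 * (M - cmod (p 0)))"
    by (simp add: h0 algebra_simps)
  then show ?thesis using N by simp
qed

section \<open>Homogeneous parts and mixed differences\<close>

definition hom_part :: "nat \<Rightarrow> (nat set \<Rightarrow> complex) \<Rightarrow> nat set \<Rightarrow> complex" where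
  "hom_part m c = (\<lambda>S. if card S = m then c S else 0)"

lemma tetra_hom_part: "finite V \<Longrightarrow> tetra V (hom_part m c) z = (\<Sum>S\<in>subsets_card V m. c S * (\<Prod>i\<in>S. z i))"
  unfolding tetra_def hom_part_def
  by (rule sum.mono_neutral_cong_right) (auto simp: subsets_card_def)

lemma tetra_hom_part_scale: "finite V \<Longrightarrow> tetra V (hom_part m c) (\<lambda>i. t * z i) = t ^ m * tetra V (hom_part m c) z"
  by (simp add: tetra_hom_part prod.distrib sum_distrib_left subsets_card_def mult_ac)

lemma tetra_eq_sum_hom_part:
  "finite V \<Longrightarrow> tetra V c z = (\<Sum>m\<le>card V. tetra V (hom_part m c) z)"
  by (simp add: tetra_hom_part) (simp add: tetra_def sum_Pow_by_card)

text \<open>By affinity, the difference of the values at steps \<open>\<rho>\<close> and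
  \<open>- \<rho>\<close> in one direction is exactly \<open>2 * \<rho>\<close> times the
  derivative, so each direction of \<open>T\<close> contributes a factor \<open>\<rho>\<close> and
  no further constant.\<close>

lemma mixed_difference_bound:
  assumes "finite V" "finite T" "T \<subseteq> V" "0 \<le> \<rho>"
    and "\<And>\<zeta>. (\<And>i. cmod (\<zeta> i) = (if i \<in> T then \<rho> else 0)) \<Longrightarrow> cmod (tetra V c (\<lambda>i. z i + \<zeta> i)) \<le> K"
  shows "\<rho> ^ card T * cmod (tetra (V - T) (\<lambda>S. c (S \<union> T)) z) \<le> K"
  using assms(2,3,5)
proof (induction T arbitrary: z rule: finite_induct)
  case empty
  then show ?case using empty.prems(2)[of "\<lambda>_. 0"] by simp
next
  case (insert a T)
  define D where "D = tetra (V - T) (\<lambda>S. c (S \<union> T))"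
  define E where "E = tetra (V - insert a T) (\<lambda>S. c (S \<union> insert a T)) z"
  \<comment> \<open>Since \<open>\<zeta> a = 0\<close>, a shift by \<open>\<epsilon>\<close> in
    direction \<open>a\<close> combines with \<open>\<zeta>\<close> to a perturbation for
    \<open>insert a T\<close>.\<close>
  have le: "\<rho> ^ card T * cmod (D (z(a := z a + \<epsilon>))) \<le> K" if "cmod \<epsilon> = \<rho>" for \<epsilon>
    unfolding D_def
  proof (rule insert.IH)
    fix \<zeta> :: "nat \<Rightarrow> complex" assume \<zeta>: "\<And>i. cmod (\<zeta> i) = (if i \<in> T then \<rho> else 0)"
    have "(\<lambda>i. (z(a := z a + \<epsilon>)) i + \<zeta> i) = (\<lambda>i. z i + (\<zeta>(a := \<epsilon>)) i)"
      using \<zeta>[of a] insert.hyps by auto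
    moreover have "cmod ((\<zeta>(a := \<epsilon>)) i) = (if i \<in> insert a T then \<rho> else 0)" for i
      using \<zeta>[of i] that by auto
    ultimately show "cmod (tetra V c (\<lambda>i. (z(a := z a + \<epsilon>)) i + \<zeta> i)) \<le> K"
      using insert.prems(2)[of "\<zeta>(a := \<epsilon>)"] by (simp only:)
  qed (use insert.prems in auto)
  have aV: "a \<in> V - T" using insert by auto
  have D_eq: "D (z(a := w)) = tetra (V - insert a T) (\<lambda>S. c (S \<union> T)) z + w * E" for w
  proof -
    have "V - T - {a} = V - insert a T" by auto
    then show ?thesis
      using tetra_remove[of "V - T" a "\<lambda>S. c (S \<union> T)" "z(a := w)"] aV \<open>finite V\<close>
      by (simp add: D_def E_def tetra_fun_upd)
  qed
  have "2 * (\<rho> ^ card (insert a T) * cmod E) = \<rho> ^ card T * cmod (D (z(a := z a + of_real \<rho>)) - D (z(a := z a + - of_real \<rho>)))"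
  proof -
    have "D (z(a := z a + of_real \<rho>)) - D (z(a := z a + - of_real \<rho>)) = of_real (2 * \<rho>) * E"
      by (simp add: D_eq algebra_simps)
    moreover have "cmod (of_real (2 * \<rho>) * E) = 2 * \<rho> * cmod E"
      using \<open>0 \<le> \<rho>\<close> unfolding norm_mult norm_of_real by simp
    ultimately show ?thesis using insert.hyps by simp
  qed
  also have "\<dots> \<le> \<rho> ^ card T * (cmod (D (z(a := z a + of_real \<rho>))) + cmod (D (z(a := z a + - of_real \<rho>))))"
    using \<open>0 \<le> \<rho>\<close> by (intro mult_left_mono norm_triangle_ineq4) auto
  also have "\<dots> \<le> 2 * K"
    using le[of "of_real \<rho>"] le[of "- of_real \<rho>"] \<open>0 \<le> \<rho>\<close> by (simp add: algebra_simps)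
  finally show ?case by (simp add: E_def)
qed

text \<open>Differentiating along \<open>T\<close> lowers the degree \<open>Suc (card T)\<close> to
  1 and leaves a linear form.\<close>

lemma tetra_derivative_linear:
  assumes "finite V" "T \<subseteq> V"
  shows "tetra (V - T) (\<lambda>S. hom_part (Suc (card T)) c (S \<union> T)) z = (\<Sum>k\<in>V - T. c (insert k T) * z k)"
proof -
  have T: "finite T" using assms finite_subset by auto
  have "tetra (V - T) (\<lambda>S. hom_part (Suc (card T)) c (S \<union> T)) z
      = tetra (V - T) (hom_part 1 (\<lambda>S. c (S \<union> T))) z"
    unfolding tetra_def
  proof (rule sum.cong)
    fix S assume "S \<in> Pow (V - T)"
    then have "finite S" "S \<inter> T = {}" using assms finite_subset[of S V] by auto
    then have "card (S \<union> T) = card S + card T" using T by (simp add: card_Un_disjoint)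
    then show "hom_part (Suc (card T)) c (S \<union> T) * prod z S = hom_part 1 (\<lambda>S. c (S \<union> T)) S * prod z S"
      by (simp add: hom_part_def)
  qed simp
  also have "\<dots> = (\<Sum>S\<in>subsets_card (V - T) 1. c (S \<union> T) * prod z S)"
    using assms by (simp add: tetra_hom_part)
  also have "\<dots> = (\<Sum>S\<in>(\<lambda>k. {k}) ` (V - T). c (S \<union> T) * prod z S)"
    by (rule sum.cong) (auto simp: subsets_card_def card_1_singleton_iff)
  also have "\<dots> = (\<Sum>k\<in>V - T. c (insert k T) * z k)"
    by (subst sum.reindex) (auto simp: inj_on_def)
  finally show ?thesis .
qed

section \<open>The lower estimate\<close>

context symmetric_lattice
begin

section \<open>Unconditional bounds for homogeneous parts\<close>

lemma hom_part_scaled_bound: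
  assumes bd: "\<And>z. z \<in> ballXn nX n 1 \<Longrightarrow> cmod (tetra {..<n} (hom_part m c) z) \<le> K"
    and w: "w \<in> cvec n" "nX w < 2"
  shows "cmod (tetra {..<n} (hom_part m c) w) \<le> 2 ^ m * K"
proof -
  define y where "y = (\<lambda>i. (1/2) * w i)"
  have "y \<in> ballXn nX n 1"
    using w norm_scale[OF cvec_in[OF w(1)], of "1/2"] by (simp add: ballXn_eq y_def cvec_def)
  moreover have "w = (\<lambda>i. 2 * y i)" by (simp add: y_def)
  ultimately show ?thesis
    using bd[of y] tetra_hom_part_scale[of "{..<n}" m c 2 y] by (simp add: norm_mult norm_power)
qed

text \<open>Differences with step \<open>1 / phi j\<close> move a point of the ball by a vector of
  norm at most 1, so the polynomial is evaluated only at norms below 2, and homogeneity charges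
  \<open>2 ^ Suc j\<close>. The phases of the point are chosen to turn the linear derivative into a
  sum of moduli.\<close>

lemma hom_part_slice_bound:
  assumes bd: "\<And>z. z \<in> ballXn nX n 1 \<Longrightarrow> cmod (tetra {..<n} (hom_part (Suc j) c) z) \<le> K"
    and z: "z \<in> ballXn nX n 1" and T: "T \<subseteq> {..<n}" "card T = j"
  shows "(\<Sum>k\<in>{..<n} - T. cmod (c (insert k T)) * cmod (z k)) \<le> 2 ^ Suc j * K * phi j ^ j"
proof -
  have fT: "finite T" using T finite_subset by auto
  \<comment> \<open>For \<open>j = 0\<close> this is 0 by division by zero; \<open>T\<close> is then
    empty and \<open>\<rho> ^ 0 = 1\<close>, so the estimate remains correct.\<close>
  define \<rho> where "\<rho> = 1 / phi j"
  have \<rho>: "0 \<le> \<rho>" using phi_nonneg by (simp add: \<rho>_def)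
  define y where "y k = cnj (sgn (c (insert k T))) * of_real (cmod (z k))" for k
  have zc: "z \<in> cvec n" "nX z < 1" using z by (auto simp: ballXn_eq)
  have yz: "cmod (y k) \<le> cmod (z k)" for k
    by (simp add: y_def norm_mult norm_sgn)
  have yc: "y \<in> cvec n" "nX y < 1"
    using zc norm_mono[OF cvec_in[OF zc(1)], of y] yz by (auto simp: y_def[abs_def] cvec_def)
  have bd2: "cmod (tetra {..<n} (hom_part (Suc j) c) (\<lambda>i. y i + \<zeta> i)) \<le> 2 ^ Suc j * K"
    if \<zeta>: "\<And>i. cmod (\<zeta> i) = (if i \<in> T then \<rho> else 0)" for \<zeta>
  proof -
    have \<zeta>c: "\<zeta> \<in> cvec n"
      unfolding cvec_def
    proof (intro CollectI allI impI)
      fix k assume "n \<le> k"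
      then have "k \<notin> T" using T by auto
      then show "\<zeta> k = 0" using \<zeta>[of k] by simp
    qed
    have ind: "(\<lambda>i. if i \<in> T then 1 else 0) \<in> Xs" by (rule cvec_in[of _ n]) (use T in \<open>auto simp: cvec_def\<close>)
    have "nX \<zeta> = nX (\<lambda>i. of_real \<rho> * (if i \<in> T then 1 else 0))"
      by (rule norm_abs_eq[OF scale_in[OF ind]]) (use \<zeta> \<rho> in \<open>auto\<close>)
    also have "\<dots> = \<rho> * phi j"
      using norm_scale[OF ind, of "of_real \<rho>"] norm_indicator[OF fT] T \<rho> by simp
    also have "\<dots> \<le> 1" by (simp add: \<rho>_def)
    finally have "nX (\<lambda>i. y i + \<zeta> i) < 2"
      using norm_triangle[OF cvec_in[OF yc(1)] cvec_in[OF \<zeta>c]] yc(2) by linarith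
    moreover have "(\<lambda>i. y i + \<zeta> i) \<in> cvec n" using yc \<zeta>c by (simp add: cvec_def)
    ultimately show ?thesis using hom_part_scaled_bound[OF bd] by blast
  qed
  define s where "s = (\<Sum>k\<in>{..<n} - T. cmod (c (insert k T)) * cmod (z k))"
  have s0: "0 \<le> s" by (simp add: s_def sum_nonneg)
  have "tetra ({..<n} - T) (\<lambda>S. hom_part (Suc j) c (S \<union> T)) y = of_real s"
  proof -
    have "c (insert k T) * y k = of_real (cmod (c (insert k T)) * cmod (z k))" for k
    proof -
      have "x * cnj (sgn x) = of_real (cmod x)" for x :: complex
        using complex_norm_square[of x]
        by (cases "x = 0") (simp_all add: sgn_div_norm scaleR_conv_of_real power2_eq_square field_simps)
      then show ?thesis by (simp add: y_def mult.assoc[symmetric])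
    qed
    then show ?thesis using tetra_derivative_linear[of "{..<n}" T c y] T by (simp add: s_def)
  qed
  then have *: "\<rho> ^ j * s \<le> 2 ^ Suc j * K"
    using mixed_difference_bound[OF finite_lessThan fT T(1) \<rho> bd2] T(2) s0 by auto
  show ?thesis
  proof (cases "j = 0")
    case False
    then have "s \<le> 2 ^ Suc j * K * phi j ^ j" using * phi_pos[of j] by (simp add: \<rho>_def field_simps power_divide)
    then show ?thesis by (simp only: s_def)
  qed (use * in \<open>simp add: s_def\<close>)
qed

text \<open>Each monomial of degree \<open>Suc j\<close> is split into one variable \<open>k\<close>
  and a monomial of degree \<open>j\<close>: the slice bound handles the sum over \<open>k\<close>,
  the elementary symmetric sum the rest.\<close>

lemma hom_part_unconditional_bound:
  assumes bd: "\<And>z. z \<in> ballXn nX n 1 \<Longrightarrow> cmod (tetra {..<n} (hom_part (Suc j) c) z) \<le> K"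
    and z: "z \<in> ballXn nX n 1"
  shows "(\<Sum>S\<in>subsets_card {..<n} (Suc j). cmod (c S) * (\<Prod>i\<in>S. cmod (z i)))
          \<le> 2 ^ Suc j * 3 ^ j * K * (phi_dual Xs nX n / phi_dual Xs nX j) ^ j"
proof -
  let ?V = "{..<n}"
  define B where "B = 2 ^ Suc j * K * phi j ^ j"
  have K: "0 \<le> K" using bd[OF z] norm_ge_zero order_trans by blast
  have zc: "z \<in> cvec n" "nX z < 1" using z by (auto simp: ballXn_eq)
  have fS: "finite S" if "S \<in> subsets_card ?V k" for S k
    using that finite_subset by (auto simp: subsets_card_def)
  have "(\<Sum>S\<in>subsets_card ?V (Suc j). cmod (c S) * (\<Prod>i\<in>S. cmod (z i)))
      \<le> (\<Sum>S\<in>subsets_card ?V (Suc j). \<Sum>k\<in>S. cmod (c S) * (\<Prod>i\<in>S. cmod (z i)))"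
  proof (rule sum_mono)
    fix S assume "S \<in> subsets_card ?V (Suc j)"
    then have "card S = Suc j" by (simp add: subsets_card_def)
    moreover have "0 \<le> cmod (c S) * (\<Prod>i\<in>S. cmod (z i))" by (simp add: prod_nonneg)
    ultimately show "cmod (c S) * (\<Prod>i\<in>S. cmod (z i)) \<le> (\<Sum>k\<in>S. cmod (c S) * (\<Prod>i\<in>S. cmod (z i)))"
      by (simp add: algebra_simps)
  qed
  also have "\<dots> = (\<Sum>T\<in>subsets_card ?V j. \<Sum>k\<in>?V - T. cmod (c (insert k T)) * (\<Prod>i\<in>insert k T. cmod (z i)))"
    by (rule sum_subsets_card_pairs) simp
  also have "\<dots> = (\<Sum>T\<in>subsets_card ?V j. (\<Prod>i\<in>T. cmod (z i)) * (\<Sum>k\<in>?V - T. cmod (c (insert k T)) * cmod (z k)))"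
    unfolding sum_distrib_left using fS by (intro sum.cong refl) (auto simp: mult_ac)
  also have "\<dots> \<le> (\<Sum>T\<in>subsets_card ?V j. (\<Prod>i\<in>T. cmod (z i)) * B)"
  proof (intro sum_mono mult_left_mono)
    fix T assume "T \<in> subsets_card ?V j"
    then show "(\<Sum>k\<in>?V - T. cmod (c (insert k T)) * cmod (z k)) \<le> B"
      unfolding B_def using hom_part_slice_bound[OF bd z] by (auto simp: subsets_card_def)
  qed (simp add: prod_nonneg)
  also have "\<dots> = (\<Sum>T\<in>subsets_card ?V j. \<Prod>i\<in>T. cmod (z i)) * B" by (simp add: sum_distrib_right)
  also have "\<dots> \<le> (phi_dual Xs nX n ^ j / fact j) * B"
  proof (rule mult_right_mono)
    show "0 \<le> B" using K phi_nonneg by (simp add: B_def)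
    have "(\<Sum>i<n. cmod (z i)) \<le> phi_dual Xs nX n * nX z" by (rule sum_le_phi_dual_norm[OF cvec_in[OF zc(1)]])
    also have "\<dots> \<le> phi_dual Xs nX n" using zc(2) phi_dual_nonneg by (simp add: mult_left_le)
    finally have s: "(\<Sum>i<n. cmod (z i)) \<le> phi_dual Xs nX n" .
    have "(\<Sum>T\<in>subsets_card ?V j. \<Prod>i\<in>T. cmod (z i)) \<le> (\<Sum>i<n. cmod (z i)) ^ j / fact j"
      by (rule sum_prod_subsets_card_le) auto
    also have "\<dots> \<le> phi_dual Xs nX n ^ j / fact j"
      by (intro divide_right_mono power_mono s) (auto simp: sum_nonneg)
    finally show "(\<Sum>T\<in>subsets_card ?V j. \<Prod>i\<in>T. cmod (z i)) \<le> phi_dual Xs nX n ^ j / fact j" .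
  qed
  also have "\<dots> \<le> 2 ^ Suc j * 3 ^ j * K * (phi_dual Xs nX n / phi_dual Xs nX j) ^ j"
  proof (cases "j = 0")
    case False
    then have pj: "0 < phi_dual Xs nX j" using phi_dual_pos by simp
    \<comment> \<open>\<open>phi j\<close> is traded for the dual function; the resulting
      \<open>j ^ j\<close> is absorbed, up to \<open>3 ^ j\<close>, by the \<open>fact j\<close> of
      the elementary symmetric sum.\<close>
    have "phi j ^ j \<le> (real j / phi_dual Xs nX j) ^ j"
      using phi_dual_phi_le[of j] pj phi_nonneg[of j] by (intro power_mono) (auto simp: field_simps)
    also have "\<dots> \<le> 3 ^ j * fact j / phi_dual Xs nX j ^ j"
      unfolding power_divide by (intro divide_right_mono self_power_le_fact) (use pj in auto)
    finally have "B \<le> 2 ^ Suc j * K * (3 ^ j * fact j / phi_dual Xs nX j ^ j)"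
      unfolding B_def using K by (intro mult_left_mono) auto
    then have "phi_dual Xs nX n ^ j / fact j * B
        \<le> phi_dual Xs nX n ^ j / fact j * (2 ^ Suc j * K * (3 ^ j * fact j / phi_dual Xs nX j ^ j))"
      using phi_dual_nonneg by (intro mult_left_mono) auto
    also have "\<dots> = 2 ^ Suc j * 3 ^ j * K * (phi_dual Xs nX n / phi_dual Xs nX j) ^ j"
      by (simp add: power_divide)
    finally show ?thesis .
  qed (simp add: B_def)
  finally show ?thesis .
qed

section \<open>From homogeneous bounds to Bohr's inequality\<close>

lemma lower_ratio_pos: "1 \<le> m \<Longrightarrow> m \<le> n \<Longrightarrow> 0 < lower_ratio Xs nX n m"
proof (cases "m = 1")
  case False
  assume "1 \<le> m" "m \<le> n"
  then have "0 < phi_dual Xs nX (m - 1)" "0 < phi_dual Xs nX n" using False by (auto intro: phi_dual_pos)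
  then show ?thesis using False by (simp add: lower_ratio_def)
qed (simp add: lower_ratio_def)

text \<open>The root in \<open>lower_ratio\<close> is taken so that this power of the radius
  compensates the last factor in \<open>hom_part_unconditional_bound\<close>. For
  \<open>j = 0\<close> both sides are 1.\<close>

lemma lower_ratio_power:
  assumes "Suc j \<le> n"
  shows "lower_ratio Xs nX n (Suc j) ^ Suc j = (phi_dual Xs nX j / phi_dual Xs nX n) ^ j"
proof (cases "j = 0")
  case False
  define a where "a = phi_dual Xs nX j / phi_dual Xs nX n"
  have a: "0 < a" using phi_dual_pos[of j] phi_dual_pos[of n] False assms by (simp add: a_def)
  have "lower_ratio Xs nX n (Suc j) ^ Suc j = (a powr (real j / real (Suc j))) ^ Suc j"
    using False by (simp add: lower_ratio_def a_def)
  also have "\<dots> = a powr (real j / real (Suc j) * real (Suc j))"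
    using a by (metis powr_powr powr_realpow powr_gt_zero less_irrefl)
  also have "\<dots> = a ^ j" using a by (simp add: powr_realpow)
  finally show ?thesis by (simp add: a_def)
qed (simp add: lower_ratio_def)

text \<open>The constant is \<open>18 = 2 * 3 * 3\<close>: the factors 2 and 3 cancel the
  exponential constants of the homogeneous bound, and the other 3 leaves a geometric series of sum
  at most \<open>1/2\<close>, which turns \<open>K\<close> into
  \<open>M - cmod (c {})\<close>.\<close>

lemma bohr_inequality:
  fixes c :: "nat set \<Rightarrow> complex"
  assumes n: "1 \<le> n" and L: "0 < L" "\<And>m. m \<in> {1..n} \<Longrightarrow> L \<le> lower_ratio Xs nX n m"
    and bd: "\<And>z. z \<in> ballXn nX n 1 \<Longrightarrow> cmod (tetra {..<n} c z) \<le> M"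
    and z: "z \<in> ballXn nX n (L / 18)"
  shows "(\<Sum>S\<in>Pow {..<n}. cmod (c S) * (\<Prod>i\<in>S. cmod (z i))) \<le> M"
proof -
  let ?V = "{..<n}"
  define K where "K = 2 * (M - cmod (c {}))"
  have c0: "tetra ?V (hom_part 0 c) w = c {}" for w
    by (simp add: tetra_hom_part subsets_card_0)
  have homK: "cmod (tetra ?V (hom_part m c) w) \<le> K" if m: "1 \<le> m" "m \<le> n" and w: "w \<in> ballXn nX n 1" for m w
  proof -
    \<comment> \<open>At \<open>\<zeta> * w\<close> the homogeneous parts become the coefficients of
      a polynomial in \<zeta>, whose constant term is \<open>c {}\<close>.\<close>
    have "cmod (tetra ?V (hom_part m c) w) \<le> 2 * (M - cmod (tetra ?V (hom_part 0 c) w))"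
    proof (rule coeff_le_of_bounded_on_circle[OF _ m])
      fix \<zeta> :: complex assume \<zeta>: "cmod \<zeta> = 1"
      have "(\<lambda>i. \<zeta> * w i) \<in> ballXn nX n 1"
        using w \<zeta> norm_scale[of w \<zeta>] cvec_in[of w n] by (auto simp: ballXn_eq cvec_def)
      from bd[OF this] have "cmod (\<Sum>k\<le>card ?V. tetra ?V (hom_part k c) (\<lambda>i. \<zeta> * w i)) \<le> M"
        by (subst (asm) tetra_eq_sum_hom_part) auto
      then show "cmod (\<Sum>k\<le>n. \<zeta> ^ k * tetra ?V (hom_part k c) w) \<le> M"
        by (simp add: tetra_hom_part_scale)
    qed
    then show ?thesis by (simp add: c0 K_def)
  qed
  have zero_ball: "(\<lambda>_. 0) \<in> ballXn nX n 1" by (simp add: ballXn_eq cvec_def norm_zero)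
  have K: "0 \<le> K" using homK[of 1, OF _ n zero_ball] norm_ge_zero order_trans by blast
  define t where "t = L / 18"
  have t: "0 < t" using L by (simp add: t_def)
  define y where "y = (\<lambda>i. of_real (1 / t) * z i)"
  have zc: "z \<in> cvec n" "nX z < t" using z by (auto simp: ballXn_eq t_def)
  have y: "y \<in> ballXn nX n 1"
  proof -
    have "nX y = (1 / t) * nX z"
      unfolding y_def norm_scale[OF cvec_in[OF zc(1)]] norm_of_real using t by simp
    then show ?thesis using zc t by (simp add: ballXn_eq y_def cvec_def)
  qed
  have zy: "cmod (z i) = t * cmod (y i)" for i using t by (simp add: y_def norm_mult norm_divide)
  have hom_le: "(\<Sum>S\<in>subsets_card ?V (Suc j). cmod (c S) * (\<Prod>i\<in>S. cmod (z i))) \<le> K * (1/3) ^ Suc j"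
    if j: "Suc j \<le> n" for j
  proof -
    define q where "q = (phi_dual Xs nX j / phi_dual Xs nX n) ^ j"
    have q: "0 < q" using lower_ratio_power[OF j] lower_ratio_pos[of "Suc j" n] j zero_less_power
      unfolding q_def by (metis One_nat_def Suc_le_mono le0)
    have "L ^ Suc j \<le> q"
      unfolding q_def lower_ratio_power[OF j, symmetric] using L j by (intro power_mono) auto
    then have tq: "t ^ Suc j \<le> q / 18 ^ Suc j"
      unfolding t_def power_divide by (intro divide_right_mono) auto
    have "(\<Sum>S\<in>subsets_card ?V (Suc j). cmod (c S) * (\<Prod>i\<in>S. cmod (z i)))
        = t ^ Suc j * (\<Sum>S\<in>subsets_card ?V (Suc j). cmod (c S) * (\<Prod>i\<in>S. cmod (y i)))"
      unfolding sum_distrib_left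
      by (intro sum.cong refl) (simp add: zy prod.distrib subsets_card_def)
    also have "\<dots> \<le> t ^ Suc j * (2 ^ Suc j * 3 ^ j * K * (phi_dual Xs nX n / phi_dual Xs nX j) ^ j)"
      using t j by (intro mult_left_mono hom_part_unconditional_bound homK y) auto
    also have "(phi_dual Xs nX n / phi_dual Xs nX j) ^ j = 1 / q"
      by (simp add: q_def power_divide)
    also have "t ^ Suc j * (2 ^ Suc j * 3 ^ j * K * (1 / q)) \<le> q / 18 ^ Suc j * (2 ^ Suc j * 3 ^ j * K * (1 / q))"
      using tq K q by (intro mult_right_mono) auto
    also have "\<dots> = K * (2 ^ Suc j * 3 ^ j / 18 ^ Suc j)" using q by simp
    also have "(2::real) ^ Suc j * 3 ^ j / 18 ^ Suc j \<le> (1/3) ^ Suc j"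
    proof -
      have "(2::real) ^ Suc j * 3 ^ j \<le> 2 ^ Suc j * 3 ^ Suc j" by simp
      also have "\<dots> = 6 ^ Suc j" by (simp only: power_mult_distrib[symmetric]) simp
      finally have "(2::real) ^ Suc j * 3 ^ j / 18 ^ Suc j \<le> 6 ^ Suc j / 18 ^ Suc j"
        by (intro divide_right_mono) auto
      also have "\<dots> = (6 / 18) ^ Suc j" by (simp only: power_divide)
      finally show ?thesis by simp
    qed
    finally show ?thesis using K by (simp add: mult_left_mono)
  qed
  have geo: "(\<Sum>j<n. (1/3::real) ^ Suc j) \<le> 1 / 2"
  proof -
    have "(\<Sum>j<n. (1/3::real) ^ Suc j) = (1 - (1/3) ^ n) / 2"
      by (induction n) (auto simp: sum.lessThan_Suc diff_divide_distrib)
    then show ?thesis by simp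
  qed
  have "(\<Sum>S\<in>Pow ?V. cmod (c S) * (\<Prod>i\<in>S. cmod (z i)))
      = (\<Sum>m\<le>n. \<Sum>S\<in>subsets_card ?V m. cmod (c S) * (\<Prod>i\<in>S. cmod (z i)))"
    using sum_Pow_by_card[of ?V] by simp
  also have "\<dots> = cmod (c {}) + (\<Sum>j<n. \<Sum>S\<in>subsets_card ?V (Suc j). cmod (c S) * (\<Prod>i\<in>S. cmod (z i)))"
    by (simp add: sum.atMost_shift subsets_card_0)
  also have "\<dots> \<le> cmod (c {}) + (\<Sum>j<n. K * (1/3) ^ Suc j)"
    by (intro add_left_mono sum_mono hom_le) auto
  also have "\<dots> \<le> cmod (c {}) + K * (1 / 2)"
    unfolding sum_distrib_left[symmetric] by (intro add_left_mono mult_left_mono geo K)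
  also have "\<dots> = M" by (simp add: K_def field_simps)
  finally show ?thesis .
qed

definition bohr_set :: "nat \<Rightarrow> real set" where
  "bohr_set n = {r. 0 < r \<and> r < 1 \<and>
     (\<forall>f. holo_on n f (ballXn nX n 1)
          \<and> (\<exists>M. \<forall>z\<in>ballXn nX n 1. cmod (f z) \<le> M)
          \<and> (\<forall>\<alpha>\<in>mindex n. \<alpha> \<notin> LambdaT n \<longrightarrow> taylor_coeff n \<alpha> f = 0)
        \<longrightarrow> (\<forall>z\<in>ballXn nX n r.
              (\<Sum>\<alpha>\<in>LambdaT n. cmod (taylor_coeff n \<alpha> f * mpow n z \<alpha>))
                \<le> (SUP w\<in>ballXn nX n 1. cmod (f w))))}"

lemma bohr_radius_eq: "bohr_radius nX n (LambdaT n) = Sup (bohr_set n)"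
  by (simp add: bohr_radius_def bohr_set_def)

text \<open>The infimum over a finite nonempty set is a minimum, hence positive; the term
  \<open>m = 1\<close> gives the bound 1, so that \<open>L / 18\<close> is below 1.\<close>

lemma lower_ratio_Inf:
  assumes "1 \<le> n"
  defines "L \<equiv> INF m\<in>{1..n}. lower_ratio Xs nX n m"
  shows "0 < L" "L \<le> 1" "\<And>m. m \<in> {1..n} \<Longrightarrow> L \<le> lower_ratio Xs nX n m"
proof -
  have fin: "finite (lower_ratio Xs nX n ` {1..n})" "lower_ratio Xs nX n ` {1..n} \<noteq> {}"
    using assms by auto
  then have "L = Min (lower_ratio Xs nX n ` {1..n})" by (simp add: L_def cInf_eq_Min)
  then show "0 < L" using fin lower_ratio_pos by (auto simp: Min_gr_iff)
  show le: "L \<le> lower_ratio Xs nX n m" if "m \<in> {1..n}" for m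
    unfolding L_def by (rule cINF_lower) (use that fin in auto)
  show "L \<le> 1" using le[of 1] assms by (simp add: lower_ratio_def)
qed

text \<open>The expansion on the ball reduces the claim to polynomials. Membership also shows that
  \<open>bohr_set n\<close> is nonempty, which bounding its supremum from above requires.\<close>

lemma bohr_set_lower:
  assumes n: "1 \<le> n"
  shows "(INF m\<in>{1..n}. lower_ratio Xs nX n m) / 18 \<in> bohr_set n"
proof -
  define L where "L = (INF m\<in>{1..n}. lower_ratio Xs nX n m)"
  note L = lower_ratio_Inf[OF n, folded L_def]
  have "(\<Sum>\<alpha>\<in>LambdaT n. cmod (taylor_coeff n \<alpha> f * mpow n z \<alpha>)) \<le> (SUP w\<in>ballXn nX n 1. cmod (f w))"
    if f: "holo_on n f (ballXn nX n 1)" and bd: "\<forall>z\<in>ballXn nX n 1. cmod (f z) \<le> M"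
      and van: "\<forall>\<alpha>\<in>mindex n. \<alpha> \<notin> LambdaT n \<longrightarrow> taylor_coeff n \<alpha> f = 0"
      and z: "z \<in> ballXn nX n (L / 18)" for f M z
    unfolding sum_LambdaT
  proof (rule bohr_inequality[OF n L(1,3) _ z])
    fix w assume w: "w \<in> ballXn nX n 1"
    have "f w = tetra {..<n} (\<lambda>S. taylor_coeff n (set_index S) f) w"
      using ball_expansion[OF f _ _ w] bd van by blast
    moreover have "cmod (f w) \<le> (SUP w\<in>ballXn nX n 1. cmod (f w))"
      using bd w by (intro cSUP_upper bdd_aboveI2) auto
    ultimately show "cmod (tetra {..<n} (\<lambda>S. taylor_coeff n (set_index S) f) w) \<le> (SUP w\<in>ballXn nX n 1. cmod (f w))"
      by simp
  qed
  then show ?thesis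
    unfolding L_def[symmetric] bohr_set_def using L(1,2) by auto
qed

lemma bohr_radius_lower:
  assumes "1 \<le> n"
  shows "(INF m\<in>{1..n}. lower_ratio Xs nX n m) \<le> 18 * bohr_radius nX n (LambdaT n)"
proof -
  have "bdd_above (bohr_set n)" by (rule bdd_aboveI[of _ 1]) (auto simp: bohr_set_def)
  then have "(INF m\<in>{1..n}. lower_ratio Xs nX n m) / 18 \<le> Sup (bohr_set n)"
    by (rule cSup_upper[OF bohr_set_lower[OF assms]])
  then show ?thesis by (simp add: bohr_radius_eq)
qed

end

section \<open>Polynomials with random signs\<close>

text \<open>A crude subgaussian bound for \<open>2 * cosh a\<close>, from quadratic upper bounds of
  \<open>exp b\<close> and \<open>exp (- b)\<close> on the unit interval.\<close>

lemma exp_plus_exp_minus_le: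
  fixes a :: real
  assumes "\<bar>a\<bar> \<le> 1"
  shows "exp a + exp (- a) \<le> 2 * exp (a\<^sup>2)"
proof -
  have *: "exp b + exp (- b) \<le> 2 * exp (b\<^sup>2)" if b: "0 \<le> b" "b \<le> 1" for b :: real
  proof -
    \<comment> \<open>The product on the right equals \<open>1 + b ^ 3\<close>.\<close>
    have "1 * 1 \<le> (1 - b + b\<^sup>2) * (1 + b)"
      using b by (simp add: algebra_simps power2_eq_square)
    also have "\<dots> \<le> (1 - b + b\<^sup>2) * exp b"
      using b exp_ge_add_one_self[of b] by (intro mult_left_mono) auto
    finally have "exp (- b) \<le> 1 - b + b\<^sup>2" by (simp add: exp_minus field_simps)
    moreover have "exp b \<le> 1 + b + b\<^sup>2" using exp_bound b by auto
    moreover have "1 + b\<^sup>2 \<le> exp (b\<^sup>2)" by (rule exp_ge_add_one_self)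
    ultimately show ?thesis by linarith
  qed
  show ?thesis using *[of a] *[of "- a"] assms by (cases "0 \<le> a") (auto simp: add.commute)
qed

text \<open>The exponential moment of a sum of independent signs, written as a sum over all sign
  patterns: it factorises over \<open>F\<close>.\<close>

lemma sum_signs_exp_le:
  fixes b :: "'s \<Rightarrow> real"
  assumes "finite F" "(\<Sum>s\<in>F. (b s)\<^sup>2) \<le> 1"
  shows "(\<Sum>\<epsilon>\<in>F \<rightarrow>\<^sub>E {-1, 1}. exp (\<Sum>s\<in>F. \<epsilon> s * b s)) \<le> 2 ^ card F * exp 1"
proof -
  have b1: "\<bar>b s\<bar> \<le> 1" if "s \<in> F" for s
  proof -
    have "(b s)\<^sup>2 \<le> (\<Sum>s\<in>F. (b s)\<^sup>2)" using assms(1) that by (intro member_le_sum) auto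
    then have "(b s)\<^sup>2 \<le> 1" using assms(2) by linarith
    then show ?thesis by (simp add: abs_square_le_1)
  qed
  have "(\<Sum>\<epsilon>\<in>F \<rightarrow>\<^sub>E {-1, 1}. exp (\<Sum>s\<in>F. \<epsilon> s * b s)) = (\<Sum>\<epsilon>\<in>F \<rightarrow>\<^sub>E {-1, 1}. \<Prod>s\<in>F. exp (\<epsilon> s * b s))"
    using assms(1) by (simp add: exp_sum)
  also have "\<dots> = (\<Prod>s\<in>F. \<Sum>e\<in>{-1, 1}. exp (e * b s))"
    using assms(1) by (subst prod_sum_PiE) auto
  also have "\<dots> \<le> (\<Prod>s\<in>F. 2 * exp ((b s)\<^sup>2))"
    using exp_plus_exp_minus_le[OF b1] by (intro prod_mono) (auto simp: add.commute intro: add_nonneg_nonneg)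
  also have "\<dots> = 2 ^ card F * exp (\<Sum>s\<in>F. (b s)\<^sup>2)"
    using assms(1) by (simp add: prod.distrib exp_sum)
  also have "\<dots> \<le> 2 ^ card F * exp 1" using assms(2) by simp
  finally show ?thesis .
qed

text \<open>Some pattern is at most average for the sum of all \<open>exp (X \<epsilon> i)\<close>
  and \<open>exp (- X \<epsilon> i)\<close>, and this sum dominates each single term. Only the
  logarithm of \<open>card I\<close> enters.\<close>

lemma exists_signs:
  fixes a :: "'i \<Rightarrow> 's \<Rightarrow> real"
  assumes F: "finite F" and I: "finite I" and le: "\<And>i. i \<in> I \<Longrightarrow> (\<Sum>s\<in>F. (a i s)\<^sup>2) \<le> 1"
  shows "\<exists>\<epsilon>::'s \<Rightarrow> real. (\<forall>s. \<bar>\<epsilon> s\<bar> = 1) \<and> (\<forall>i\<in>I. \<bar>\<Sum>s\<in>F. \<epsilon> s * a i s\<bar> \<le> ln (2 * card I) + 1)"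
proof (cases "I = {}")
  case True
  then show ?thesis by (intro exI[of _ "\<lambda>_. 1"]) auto
next
  case False
  define E where "E = (F \<rightarrow>\<^sub>E {-1, 1 :: real})"
  define X where "X \<epsilon> i = (\<Sum>s\<in>F. \<epsilon> s * a i s)" for \<epsilon> i
  define Y where "Y \<epsilon> = (\<Sum>i\<in>I. exp (X \<epsilon> i) + exp (- X \<epsilon> i))" for \<epsilon>
  have finE: "finite E" using F by (auto simp: E_def intro: finite_PiE)
  have cardE: "card E = 2 ^ card F" using F by (simp add: E_def card_PiE numeral_2_eq_2)
  have one: "(\<Sum>\<epsilon>\<in>E. exp (X \<epsilon> i) + exp (- X \<epsilon> i)) \<le> 2 ^ card F * (2 * exp 1)" if "i \<in> I" for i
    using sum_signs_exp_le[OF F, of "a i"] sum_signs_exp_le[OF F, of "\<lambda>s. - a i s"] le[OF that]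
    by (simp add: E_def X_def sum.distrib sum_negf)
  have "(\<Sum>\<epsilon>\<in>E. Y \<epsilon>) = (\<Sum>i\<in>I. \<Sum>\<epsilon>\<in>E. exp (X \<epsilon> i) + exp (- X \<epsilon> i))"
    unfolding Y_def by (rule sum.swap)
  also have "\<dots> \<le> (\<Sum>i\<in>I. 2 ^ card F * (2 * exp 1))" by (rule sum_mono[OF one])
  also have "\<dots> = (\<Sum>\<epsilon>\<in>E. 2 * card I * exp 1)" by (simp add: cardE)
  finally have total: "(\<Sum>\<epsilon>\<in>E. Y \<epsilon>) \<le> (\<Sum>\<epsilon>\<in>E. 2 * card I * exp 1)" .
  obtain \<epsilon> where \<epsilon>: "\<epsilon> \<in> E" "Y \<epsilon> \<le> 2 * card I * exp 1"
  proof (rule ccontr)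
    assume "\<not> thesis"
    then have "\<And>\<epsilon>. \<epsilon> \<in> E \<Longrightarrow> 2 * card I * exp 1 < Y \<epsilon>" using that by force
    moreover have "E \<noteq> {}" using cardE by (metis card.empty power_not_zero zero_neq_numeral)
    ultimately have "(\<Sum>\<epsilon>\<in>E. 2 * card I * exp 1) < (\<Sum>\<epsilon>\<in>E. Y \<epsilon>)" using finE by (intro sum_strict_mono) auto
    then show False using total by linarith
  qed
  have bound: "\<bar>X \<epsilon> i\<bar> \<le> ln (2 * card I) + 1" if i: "i \<in> I" for i
  proof -
    have "exp \<bar>X \<epsilon> i\<bar> \<le> exp (X \<epsilon> i) + exp (- X \<epsilon> i)" by (cases "0 \<le> X \<epsilon> i") auto
    also have "\<dots> \<le> Y \<epsilon>" unfolding Y_def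
      using I i by (intro member_le_sum[where f = "\<lambda>i. exp (X \<epsilon> i) + exp (- X \<epsilon> i)"]) (auto intro: add_nonneg_nonneg)
    also have "\<dots> \<le> 2 * card I * exp 1" by (rule \<epsilon>)
    also have "\<dots> = exp (ln (2 * card I) + 1)"
      using I False by (simp add: exp_add card_gt_0_iff)
    finally show ?thesis by simp
  qed
  \<comment> \<open>Elements of \<open>E\<close> are \<open>undefined\<close> outside
    \<open>F\<close>; the value 1 there gives signs everywhere without changing the sums.\<close>
  define \<epsilon>' where "\<epsilon>' s = (if s \<in> F then \<epsilon> s else 1)" for s
  have "\<bar>\<epsilon>' s\<bar> = 1" for s using \<epsilon>(1) by (auto simp: \<epsilon>'_def E_def PiE_def Pi_def)
  moreover have "(\<Sum>s\<in>F. \<epsilon>' s * a i s) = X \<epsilon> i" for i by (simp add: X_def \<epsilon>'_def)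
  ultimately show ?thesis using bound by (intro exI[of _ \<epsilon>']) auto
qed

text \<open>Real and imaginary parts are treated as separate real forms, which doubles the number of
  forms; adding the two estimates gives the factor 2.\<close>

lemma exists_signs_complex:
  fixes a :: "'i \<Rightarrow> 's \<Rightarrow> complex"
  assumes F: "finite F" and I: "finite I" and le: "\<And>i. i \<in> I \<Longrightarrow> (\<Sum>s\<in>F. (cmod (a i s))\<^sup>2) \<le> 1"
  shows "\<exists>\<epsilon>::'s \<Rightarrow> real. (\<forall>s. \<bar>\<epsilon> s\<bar> = 1) \<and>
           (\<forall>i\<in>I. cmod (\<Sum>s\<in>F. of_real (\<epsilon> s) * a i s) \<le> 2 * (ln (4 * card I) + 1))"
proof -
  define b where "b j s = (if snd j then Re (a (fst j) s) else Im (a (fst j) s))" for j :: "'i \<times> bool" and s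
  define J where "J = I \<times> (UNIV :: bool set)"
  have J: "finite J" using I by (simp add: J_def)
  have bJ: "(\<Sum>s\<in>F. (b j s)\<^sup>2) \<le> 1" if "j \<in> J" for j
  proof -
    have "(\<Sum>s\<in>F. (b j s)\<^sup>2) \<le> (\<Sum>s\<in>F. (cmod (a (fst j) s))\<^sup>2)"
      by (intro sum_mono) (auto simp: b_def cmod_power2)
    also have "\<dots> \<le> 1" using le that by (auto simp: J_def)
    finally show ?thesis .
  qed
  obtain \<epsilon> :: "'s \<Rightarrow> real" where
    \<epsilon>: "\<forall>s. \<bar>\<epsilon> s\<bar> = 1" "\<forall>j\<in>J. \<bar>\<Sum>s\<in>F. \<epsilon> s * b j s\<bar> \<le> ln (2 * card J) + 1"
    using exists_signs[OF F J, of b] bJ by blast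
  have "card J = 2 * card I" by (simp add: J_def card_cartesian_product)
  then have cJ: "2 * card J = 4 * card I" by simp
  have "cmod (\<Sum>s\<in>F. of_real (\<epsilon> s) * a i s) \<le> 2 * (ln (4 * card I) + 1)" if "i \<in> I" for i
  proof -
    have "cmod (\<Sum>s\<in>F. of_real (\<epsilon> s) * a i s)
        \<le> \<bar>Re (\<Sum>s\<in>F. of_real (\<epsilon> s) * a i s)\<bar> + \<bar>Im (\<Sum>s\<in>F. of_real (\<epsilon> s) * a i s)\<bar>"
      by (rule cmod_le)
    also have "\<dots> = \<bar>\<Sum>s\<in>F. \<epsilon> s * b (i, True) s\<bar> + \<bar>\<Sum>s\<in>F. \<epsilon> s * b (i, False) s\<bar>"
      by (simp add: b_def)
    also have "\<dots> \<le> (ln (4 * card I) + 1) + (ln (4 * card I) + 1)"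
      using \<epsilon>(2) that unfolding cJ by (intro add_mono) (auto simp: J_def)
    finally show ?thesis by simp
  qed
  then show ?thesis using \<epsilon>(1) by blast
qed

section \<open>Discretisation and the choice of signs on the l2 ball\<close>

definition grid :: "nat \<Rightarrow> complex set" where
  "grid M = (\<lambda>(k, l). Complex (of_int k / real M) (of_int l / real M)) ` ({- int M..int M} \<times> {- int M..int M})"

lemma finite_grid: "finite (grid M)" by (simp add: grid_def)

lemma card_grid: "card (grid M) \<le> (2 * M + 1)\<^sup>2"
proof -
  have "card (grid M) \<le> card ({- int M..int M} \<times> {- int M..int M})"
    unfolding grid_def by (rule card_image_le) simp
  also have "\<dots> = (2 * M + 1)\<^sup>2" by (simp add: card_cartesian_product power2_eq_square nat_add_distrib nat_mult_distrib)
  finally show ?thesis .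
qed

text \<open>Rounding goes towards 0, so that moduli do not grow and rounded vectors stay in the l2
  ball.\<close>

lemma real_grid_approx:
  fixes x :: real
  assumes "\<bar>x\<bar> \<le> 1" "0 < M"
  shows "\<exists>k\<in>{- int M..int M}. \<bar>of_int k / real M\<bar> \<le> \<bar>x\<bar> \<and> \<bar>x - of_int k / real M\<bar> \<le> 1 / real M"
proof -
  have *: "\<exists>k. 0 \<le> k \<and> k \<le> int M \<and> of_int k / real M \<le> y \<and> y - of_int k / real M \<le> 1 / real M"
    if y: "0 \<le> y" "y \<le> 1" for y :: real
  proof (intro exI conjI)
    let ?k = "\<lfloor>y * real M\<rfloor>"
    have "y * real M \<le> real M" using y by (simp add: mult_left_le_one_le)
    then show "?k \<le> int M" by linarith
    show "0 \<le> ?k" using y by simp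
    have "of_int ?k \<le> y * real M" "y * real M \<le> of_int ?k + 1" by linarith+
    then show "of_int ?k / real M \<le> y" using assms(2) by (simp add: field_simps)
    have "y - of_int ?k / real M = (y * real M - of_int ?k) / real M" using assms(2) by (simp add: field_simps)
    also have "\<dots> \<le> 1 / real M" by (intro divide_right_mono) linarith+
    finally show "y - of_int ?k / real M \<le> 1 / real M" .
  qed
  from *[of "\<bar>x\<bar>"] assms obtain k where
    k: "0 \<le> k" "k \<le> int M" "of_int k / real M \<le> \<bar>x\<bar>" "\<bar>x\<bar> - of_int k / real M \<le> 1 / real M" by auto
  show ?thesis
  proof (cases "0 \<le> x")
    case True
    then show ?thesis using k by (intro bexI[of _ k]) auto
  next
    case False
    then show ?thesis using k by (intro bexI[of _ "- k"]) auto
  qed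
qed

lemma grid_approx:
  assumes "cmod z \<le> 1" "0 < M"
  shows "\<exists>g\<in>grid M. cmod g \<le> cmod z \<and> cmod (z - g) \<le> 2 / real M"
proof -
  have "\<bar>Re z\<bar> \<le> 1" "\<bar>Im z\<bar> \<le> 1" using assms(1) abs_Re_le_cmod[of z] abs_Im_le_cmod[of z] by linarith+
  from real_grid_approx[OF this(1) assms(2)] real_grid_approx[OF this(2) assms(2)]
  obtain k l where kl: "k \<in> {- int M..int M}" "l \<in> {- int M..int M}"
    "\<bar>of_int k / real M\<bar> \<le> \<bar>Re z\<bar>" "\<bar>Re z - of_int k / real M\<bar> \<le> 1 / real M"
    "\<bar>of_int l / real M\<bar> \<le> \<bar>Im z\<bar>" "\<bar>Im z - of_int l / real M\<bar> \<le> 1 / real M" by blast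
  define g where "g = Complex (of_int k / real M) (of_int l / real M)"
  have "g \<in> grid M" using kl by (auto simp: grid_def g_def)
  moreover have "cmod g \<le> cmod z"
    unfolding cmod_def g_def complex.sel
    using abs_le_square_iff[THEN iffD1, OF kl(3)] abs_le_square_iff[THEN iffD1, OF kl(5)]
    by (intro real_sqrt_le_mono add_mono)
  moreover have "cmod (z - g) \<le> 2 / real M"
    using cmod_le[of "z - g"] kl(4,6) by (simp add: g_def)
  ultimately show ?thesis by blast
qed

text \<open>A mixed derivative along \<open>A\<close> becomes a form in the signs indexed by all
  \<open>S\<close>, so that one choice of signs can serve every \<open>A\<close>.\<close>

lemma sum_supersets:
  fixes H :: "'a set \<Rightarrow> 'b::comm_monoid_add"
  assumes "finite V" "A \<subseteq> V" "card A + k = m"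
  shows "(\<Sum>S\<in>Pow V. if A \<subseteq> S \<and> card S = m then H S else 0) = (\<Sum>B\<in>subsets_card (V - A) k. H (A \<union> B))"
proof -
  have A: "finite A" using assms finite_subset by auto
  have "(\<Sum>S\<in>Pow V. if A \<subseteq> S \<and> card S = m then H S else 0) = (\<Sum>S\<in>{S \<in> Pow V. A \<subseteq> S \<and> card S = m}. H S)"
    using assms by (intro sum.inter_filter[symmetric]) auto
  also have "\<dots> = (\<Sum>B\<in>subsets_card (V - A) k. H (A \<union> B))"
  proof (rule sum.reindex_bij_witness[where j = "\<lambda>S. S - A" and i = "\<lambda>B. A \<union> B"])
    fix S assume S: "S \<in> {S \<in> Pow V. A \<subseteq> S \<and> card S = m}"
    then show "A \<union> (S - A) = S" by auto
    show "S - A \<in> subsets_card (V - A) k"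
      using S assms(3) card_Diff_subset[OF A, of S] by (auto simp: subsets_card_def)
    show "H (A \<union> (S - A)) = H S" using \<open>A \<union> (S - A) = S\<close> by simp
  next
    fix B assume B: "B \<in> subsets_card (V - A) k"
    then have "finite B" "A \<inter> B = {}" using assms(1) finite_subset[of B V] by (auto simp: subsets_card_def)
    then have "card (A \<union> B) = m" using A assms(3) B by (simp add: card_Un_disjoint subsets_card_def)
    then show "A \<union> B \<in> {S \<in> Pow V. A \<subseteq> S \<and> card S = m}" using B assms(2) by (auto simp: subsets_card_def)
    show "A \<union> B - A = B" using \<open>A \<inter> B = {}\<close> by auto
  qed
  finally show ?thesis .
qed

text \<open>The argument of \<open>ln\<close> bounds 4 times the number of pairs of a subset of
  \<open>{..<n}\<close> and a grid vector. Since \<open>fact n \<le> 2 ^ (n * n)\<close>, it is at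
  most a power of 2 with exponent cubic in \<open>n\<close>.\<close>

lemma grid_size_bound:
  assumes "1 \<le> n"
  shows "ln (4 * (2 ^ n * ((2 * (2 * n * 2 ^ n * fact n) + 1)\<^sup>2) ^ n) :: real) \<le> 15 * real n ^ 3"
proof -
  define e where "e = n + n + n * n"
  have n2: "n \<le> 2 ^ n" by (simp add: less_imp_le)
  have "fact n \<le> n ^ n" using fact_le_power[of n] by (metis of_nat_id)
  also have "\<dots> \<le> (2 ^ n) ^ n" by (intro power_mono n2) auto
  finally have f: "fact n \<le> (2::nat) ^ (n * n)" by (simp add: power_mult)
  have "2 * n * 2 ^ n * fact n \<le> (2 * 2 ^ n * 2 ^ n * 2 ^ (n * n) :: nat)"
    by (intro mult_mono n2 f order_refl) auto
  also have "\<dots> = 2 ^ (1 + e)" unfolding e_def by (simp only: power_add power_one_right mult.assoc)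
  finally have M: "2 * n * 2 ^ n * fact n \<le> (2::nat) ^ (1 + e)" .
  have "2 * (2 * n * 2 ^ n * fact n) + 1 \<le> 2 * 2 ^ (1 + e) + (2::nat) ^ (1 + e)"
    using M by (intro add_mono) auto
  also have "\<dots> \<le> 4 * 2 ^ (1 + e)" by simp
  also have "\<dots> = 2 ^ (3 + e)" by (simp add: power_add)
  also have "\<dots> \<le> 2 ^ (6 * (n * n))"
  proof (rule power_increasing)
    have "n \<le> n * n" "1 \<le> n * n" using assms by auto
    then show "3 + e \<le> 6 * (n * n)" unfolding e_def by linarith
  qed simp
  finally have "2 * (2 * n * 2 ^ n * fact n) + 1 \<le> (2::nat) ^ (6 * (n * n))" .
  then have "((2 * (2 * n * 2 ^ n * fact n) + 1)\<^sup>2) ^ n \<le> (((2::nat) ^ (6 * (n * n)))\<^sup>2) ^ n"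
    by (intro power_mono) auto
  also have "\<dots> = 2 ^ (12 * n ^ 3)"
    by (simp add: power_mult[symmetric] power3_eq_cube mult_ac)
  finally have p: "((2 * (2 * n * 2 ^ n * fact n) + 1)\<^sup>2) ^ n \<le> (2::nat) ^ (12 * n ^ 3)" .
  have "4 * (2 ^ n * ((2 * (2 * n * 2 ^ n * fact n) + 1)\<^sup>2) ^ n) \<le> 4 * (2 ^ n * (2::nat) ^ (12 * n ^ 3))"
    by (intro mult_left_mono p) auto
  also have "\<dots> = 2 ^ (2 + n + 12 * n ^ 3)" by (simp add: power_add)
  also have "\<dots> \<le> 2 ^ (15 * n ^ 3)"
  proof (rule power_increasing)
    have "n \<le> n ^ 3" "1 \<le> n ^ 3" using assms by (auto simp: power3_eq_cube)
    then show "2 + n + 12 * n ^ 3 \<le> 15 * n ^ 3" by linarith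
  qed simp
  finally have "4 * (2 ^ n * ((2 * (2 * n * 2 ^ n * fact n) + 1)\<^sup>2) ^ n) \<le> (2::nat) ^ (15 * n ^ 3)" .
  then have "real (4 * (2 ^ n * ((2 * (2 * n * 2 ^ n * fact n) + 1)\<^sup>2) ^ n)) \<le> real (2 ^ (15 * n ^ 3))"
    by (rule of_nat_mono)
  then have le: "4 * (2 ^ n * ((2 * (2 * real n * 2 ^ n * fact n) + 1)\<^sup>2) ^ n) \<le> 2 ^ (15 * n ^ 3)"
    by (simp add: add.commute)
  have "0 < 2 * (2 * real n * 2 ^ n * fact n) + 1" by (simp add: add_nonneg_pos)
  then have pos: "0 < 4 * (2 ^ n * ((2 * (2 * real n * 2 ^ n * fact n) + 1)\<^sup>2) ^ n)" by simp
  have "ln (4 * (2 ^ n * ((2 * (2 * real n * 2 ^ n * fact n) + 1)\<^sup>2) ^ n)) \<le> ln (2 ^ (15 * n ^ 3))"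
    using le pos by simp
  also have "\<dots> = 15 * real n ^ 3 * ln 2" by (simp add: ln_realpow)
  also have "\<dots> \<le> 15 * real n ^ 3 * 1" using ln_2_less_1 by (intro mult_left_mono) auto
  finally show ?thesis by (simp add: add.commute)
qed

text \<open>Rounding \<open>v\<close> to a grid so fine that the trivial Lipschitz bound suffices is affordable: only the
  logarithm of the number of grid points enters, and any power of \<open>n\<close> is at most exponential in
  \<open>m = \<lceil>ln n\<rceil>\<close>, hence bounded after taking \<open>m\<close>-th roots.\<close>

lemma exists_sign_polynomial:
  assumes n: "1 \<le> n" and mn: "m \<le> n"
  shows "\<exists>\<epsilon>::nat set \<Rightarrow> real. (\<forall>S. \<bar>\<epsilon> S\<bar> = 1) \<and>
    (\<forall>A k v. A \<subseteq> {..<n} \<longrightarrow> card A + k = m \<longrightarrow> (\<Sum>i<n. (cmod (v i))\<^sup>2) \<le> 1 \<longrightarrow>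
       cmod (\<Sum>B\<in>subsets_card ({..<n} - A) k. of_real (\<epsilon> (A \<union> B)) * (\<Prod>i\<in>B. v i)) \<le> 33 * real n ^ 3 / sqrt (fact k))"
proof -
  let ?V = "{..<n}"
  \<comment> \<open>The mesh is chosen so that \<open>2 ^ n\<close> monomials, each changing by at
    most \<open>n * (2 / M)\<close>, give a total error of \<open>1 / fact n\<close>.\<close>
  define M :: nat where "M = 2 * n * 2 ^ n * fact n"
  have M: "0 < M" using n by (simp add: M_def)
  define G where "G = (?V \<rightarrow>\<^sub>E grid M)"
  have finG: "finite G" unfolding G_def by (intro finite_PiE) (auto simp: finite_grid)
  have cardG: "card G \<le> ((2 * M + 1)\<^sup>2) ^ n"
    using power_mono[OF card_grid] by (simp add: G_def card_PiE del: One_nat_def)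
  define I where "I = {(A, g) \<in> Pow ?V \<times> G. (\<Sum>i<n. (cmod (g i))\<^sup>2) \<le> 1}"
  have finI: "finite I" unfolding I_def by (rule finite_subset[of _ "Pow ?V \<times> G"]) (use finG in auto)
  have "card I \<le> card (Pow ?V \<times> G)" unfolding I_def by (rule card_mono) (use finG in auto)
  also have "\<dots> \<le> 2 ^ n * ((2 * M + 1)\<^sup>2) ^ n"
    using cardG by (simp add: card_cartesian_product card_Pow)
  finally have cardI: "card I \<le> 2 ^ n * ((2 * M + 1)\<^sup>2) ^ n" .
  \<comment> \<open>The square root normalises the form: by the elementary symmetric estimate its
    squared coefficients then sum to at most 1.\<close>
  define a where "a p S = (if fst p \<subseteq> S \<and> card S = m
      then of_real (sqrt (fact (m - card (fst p)))) * (\<Prod>i\<in>S - fst p. snd p i) else 0)"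
    for p :: "nat set \<times> (nat \<Rightarrow> complex)" and S
  have diff: "A \<union> B - A = B" if "B \<in> subsets_card (?V - A) k" for A B k
    using that by (auto simp: subsets_card_def)
  have a_le: "(\<Sum>S\<in>Pow ?V. (cmod (a p S))\<^sup>2) \<le> 1" if pI: "p \<in> I" for p
  proof -
    obtain A g where p: "p = (A, g)" "A \<subseteq> ?V" "(\<Sum>i<n. (cmod (g i))\<^sup>2) \<le> 1"
      using pI by (auto simp: I_def)
    show ?thesis
    proof (cases "card A \<le> m")
      case True
      define k where "k = m - card A"
      have k: "card A + k = m" using True by (simp add: k_def)
      have "(\<Sum>S\<in>Pow ?V. (cmod (a p S))\<^sup>2)
          = (\<Sum>S\<in>Pow ?V. if A \<subseteq> S \<and> card S = m then fact k * (\<Prod>i\<in>S - A. (cmod (g i))\<^sup>2) else 0)"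
        by (intro sum.cong refl) (auto simp: a_def p k_def norm_mult power_mult_distrib prod_norm[symmetric] prod_power_distrib)
      also have "\<dots> = (\<Sum>B\<in>subsets_card (?V - A) k. fact k * (\<Prod>i\<in>B. (cmod (g i))\<^sup>2))"
        using sum_supersets[OF finite_lessThan p(2) k, of "\<lambda>S. fact k * (\<Prod>i\<in>S - A. (cmod (g i))\<^sup>2) :: real"] diff
        by simp
      also have "\<dots> = fact k * (\<Sum>B\<in>subsets_card (?V - A) k. \<Prod>i\<in>B. (cmod (g i))\<^sup>2)"
        by (simp add: sum_distrib_left)
      also have "\<dots> \<le> fact k * ((\<Sum>i\<in>?V - A. (cmod (g i))\<^sup>2) ^ k / fact k)"
        by (intro mult_left_mono sum_prod_subsets_card_le) auto
      also have "\<dots> = (\<Sum>i\<in>?V - A. (cmod (g i))\<^sup>2) ^ k" by simp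
      also have "\<dots> \<le> 1"
      proof (rule power_le_one)
        have "(\<Sum>i\<in>?V - A. (cmod (g i))\<^sup>2) \<le> (\<Sum>i<n. (cmod (g i))\<^sup>2)" by (rule sum_mono2) auto
        then show "(\<Sum>i\<in>?V - A. (cmod (g i))\<^sup>2) \<le> 1" using p by linarith
      qed (simp add: sum_nonneg)
      finally show ?thesis .
    next
      case False
      \<comment> \<open>Here \<open>card A > m\<close>, so truncated subtraction makes
        \<open>m - card A\<close> zero, but no \<open>S\<close> of size \<open>m\<close> contains
        \<open>A\<close>.\<close>
      have "a p S = 0" if "S \<in> Pow ?V" for S
      proof -
        have "finite S" using that finite_subset by auto
        then have "\<not> (A \<subseteq> S \<and> card S = m)" using False card_mono[of S A] by auto
        then show ?thesis by (auto simp: a_def p)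
      qed
      then show ?thesis by simp
    qed
  qed
  obtain \<epsilon> :: "nat set \<Rightarrow> real" where \<epsilon>: "\<forall>S. \<bar>\<epsilon> S\<bar> = 1"
    "\<forall>p\<in>I. cmod (\<Sum>S\<in>Pow ?V. of_real (\<epsilon> S) * a p S) \<le> 2 * (ln (4 * card I) + 1)"
    using exists_signs_complex[OF _ finI, of "Pow ?V" a] a_le by auto
  have n3: "1 \<le> real n ^ 3" using n by simp
  have R: "2 * (ln (4 * card I) + 1) \<le> 32 * real n ^ 3" if "I \<noteq> {}"
  proof -
    have "0 < card I" using that finI by (simp add: card_gt_0_iff)
    moreover have "real (card I) \<le> real (2 ^ n * ((2 * M + 1)\<^sup>2) ^ n)" by (rule of_nat_mono[OF cardI])
    ultimately have "ln (4 * card I) \<le> ln (4 * (2 ^ n * ((2 * (2 * n * 2 ^ n * fact n) + 1)\<^sup>2) ^ n) :: real)"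
      by (subst ln_le_cancel_iff) (auto simp: M_def intro: less_le_trans)
    then show ?thesis using grid_size_bound[OF n] n3 by simp
  qed
  have main: "cmod (\<Sum>B\<in>subsets_card (?V - A) k. of_real (\<epsilon> (A \<union> B)) * (\<Prod>i\<in>B. v i)) \<le> 33 * real n ^ 3 / sqrt (fact k)"
    if A: "A \<subseteq> ?V" and k: "card A + k = m" and v: "(\<Sum>i<n. (cmod (v i))\<^sup>2) \<le> 1" for A k v
  proof -
    define Q where "Q x = (\<Sum>B\<in>subsets_card (?V - A) k. of_real (\<epsilon> (A \<union> B)) * (\<Prod>i\<in>B. x i))" for x :: "nat \<Rightarrow> complex"
    have v1: "cmod (v i) \<le> 1" if "i < n" for i
    proof -
      have "(cmod (v i))\<^sup>2 \<le> (\<Sum>i<n. (cmod (v i))\<^sup>2)" using that by (intro member_le_sum) auto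
      then have "(cmod (v i))\<^sup>2 \<le> 1" using v by linarith
      then show ?thesis by (simp add: abs_square_le_1)
    qed
    have "\<forall>i\<in>?V. \<exists>g\<in>grid M. cmod g \<le> cmod (v i) \<and> cmod (v i - g) \<le> 2 / real M"
      using grid_approx[OF v1 M] by auto
    then obtain g0 where g0: "\<And>i. i < n \<Longrightarrow> g0 i \<in> grid M \<and> cmod (g0 i) \<le> cmod (v i) \<and> cmod (v i - g0 i) \<le> 2 / real M"
      by (metis bchoice lessThan_iff)
    define g where "g = restrict g0 ?V"
    have g: "g \<in> G" "\<And>i. i < n \<Longrightarrow> cmod (g i) \<le> cmod (v i) \<and> cmod (v i - g i) \<le> 2 / real M"
      using g0 by (auto simp: g_def G_def)
    have "(\<Sum>i<n. (cmod (g i))\<^sup>2) \<le> (\<Sum>i<n. (cmod (v i))\<^sup>2)"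
      using g(2) by (intro sum_mono power_mono) auto
    then have gI: "(A, g) \<in> I" using v A g by (auto simp: I_def)
    have "(\<Sum>S\<in>Pow ?V. of_real (\<epsilon> S) * a (A, g) S)
        = (\<Sum>S\<in>Pow ?V. if A \<subseteq> S \<and> card S = m
            then of_real (\<epsilon> S) * (of_real (sqrt (fact k)) * (\<Prod>i\<in>S - A. g i)) else 0)"
      using k by (intro sum.cong refl) (auto simp: a_def)
    also have "\<dots> = (\<Sum>B\<in>subsets_card (?V - A) k. of_real (\<epsilon> (A \<union> B)) * (of_real (sqrt (fact k)) * (\<Prod>i\<in>B. g i)))"
      using sum_supersets[OF finite_lessThan A k,
          of "\<lambda>S. of_real (\<epsilon> S) * (of_real (sqrt (fact k)) * (\<Prod>i\<in>S - A. g i)) :: complex"] diff by simp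
    also have "\<dots> = of_real (sqrt (fact k)) * Q g"
      by (simp add: Q_def sum_distrib_left mult_ac)
    finally have "cmod (of_real (sqrt (fact k)) * Q g) \<le> 2 * (ln (4 * card I) + 1)"
      using \<epsilon>(2) gI by metis
    then have "sqrt (fact k) * cmod (Q g) \<le> 32 * real n ^ 3"
      using R gI by (force simp: norm_mult)
    then have Qg: "cmod (Q g) \<le> 32 * real n ^ 3 / sqrt (fact k)" by (simp add: field_simps)
    have dB: "cmod ((\<Prod>i\<in>B. v i) - (\<Prod>i\<in>B. g i)) \<le> real n * (2 / real M)" if B: "B \<in> subsets_card (?V - A) k" for B
    proof -
      have Bn: "B \<subseteq> ?V" "finite B" using B finite_subset[of B ?V] by (auto simp: subsets_card_def)
      have "cmod ((\<Prod>i\<in>B. v i) - (\<Prod>i\<in>B. g i)) \<le> (\<Sum>i\<in>B. cmod (v i - g i))"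
      proof (rule norm_prod_diff)
        fix i assume "i \<in> B"
        then have "i < n" using Bn by auto
        then show "cmod (v i) \<le> 1" "cmod (g i) \<le> 1" using v1[of i] g(2)[of i] by linarith+
      qed
      also have "\<dots> \<le> real (card B) * (2 / real M)" by (rule sum_bounded_above) (use Bn g(2) in auto)
      also have "\<dots> \<le> real n * (2 / real M)"
        using card_mono[OF _ Bn(1)] by (intro mult_right_mono) auto
      finally show ?thesis .
    qed
    have "cmod (Q v - Q g) \<le> (\<Sum>B\<in>subsets_card (?V - A) k. real n * (2 / real M))"
      unfolding Q_def sum_subtractf[symmetric] right_diff_distrib[symmetric]
      by (rule sum_norm_le) (use \<epsilon>(1) dB in \<open>simp add: norm_mult\<close>)
    also have "\<dots> = real (card (subsets_card (?V - A) k)) * (real n * (2 / real M))" by simp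
    also have "\<dots> \<le> 2 ^ n * (real n * (2 / real M))"
    proof (rule mult_right_mono)
      have "card (subsets_card (?V - A) k) \<le> card (Pow ?V)"
        by (rule card_mono) (auto simp: subsets_card_def)
      then have "real (card (subsets_card (?V - A) k)) \<le> real (2 ^ n)"
        unfolding card_Pow[OF finite_lessThan] card_lessThan by (rule of_nat_mono)
      then show "real (card (subsets_card (?V - A) k)) \<le> 2 ^ n" by simp
    qed simp
    also have "\<dots> = 1 / fact n" using n by (simp add: M_def field_simps)
    \<comment> \<open>Uses \<open>k \<le> m \<le> n\<close>; this error raises the constant from 32
      to 33.\<close>
    also have "\<dots> \<le> 1 / sqrt (fact k)"
    proof -
      have "1 \<le> (fact k :: real)" by simp
      then have "sqrt (fact k) \<le> sqrt ((fact k)\<^sup>2)" by (intro real_sqrt_le_mono) (simp add: power2_eq_square)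
      then have "sqrt (fact k) \<le> fact k" by simp
      also have "\<dots> \<le> fact n" using k mn by (intro fact_mono) auto
      finally show ?thesis by (intro divide_left_mono) auto
    qed
    finally have "cmod (Q v - Q g) \<le> 1 / sqrt (fact k)" .
    moreover have "cmod (Q v) \<le> cmod (Q g) + cmod (Q v - Q g)" by (metis norm_triangle_sub)
    ultimately have "cmod (Q v) \<le> 32 * real n ^ 3 / sqrt (fact k) + 1 / sqrt (fact k)" using Qg by linarith
    also have "\<dots> \<le> 33 * real n ^ 3 / sqrt (fact k)"
      unfolding add_divide_distrib[symmetric] using n3 by (intro divide_right_mono) auto
    finally show ?thesis by (simp add: Q_def)
  qed
  show ?thesis using \<epsilon>(1) main by blast
qed

section \<open>From the l2 ball to the lr ball\<close>

lemma sum_subsets_card_split: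
  fixes H :: "'a set \<Rightarrow> 'b::comm_monoid_add"
  assumes "finite V" "U \<subseteq> V"
  shows "(\<Sum>S\<in>subsets_card V m. H S) =
         (\<Sum>k\<le>m. \<Sum>A\<in>subsets_card U k. \<Sum>B\<in>subsets_card (V - U) (m - k). H (A \<union> B))"
proof -
  have fin: "finite S" if "S \<subseteq> V" for S using that assms(1) finite_subset by auto
  have finU: "finite U" "finite (V - U)" using assms fin by auto
  have card_eq: "card S = card (S \<inter> U) + card (S - U)" if "S \<subseteq> V" for S
    using card_Int_Diff[OF fin[OF that], of U] .
  have "(\<Sum>S\<in>subsets_card V m. H S) = (\<Sum>k\<le>m. sum H {S \<in> subsets_card V m. card (S \<inter> U) = k})"
    using assms(1) by (intro sum.group[symmetric]) (auto simp: finite_subsets_card subsets_card_def intro!: card_mono fin)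
  also have "\<dots> = (\<Sum>k\<le>m. \<Sum>(A, B)\<in>subsets_card U k \<times> subsets_card (V - U) (m - k). H (A \<union> B))"
  proof (intro sum.cong refl)
    fix k assume k: "k \<in> {..m}"
    show "sum H {S \<in> subsets_card V m. card (S \<inter> U) = k}
        = (\<Sum>(A, B)\<in>subsets_card U k \<times> subsets_card (V - U) (m - k). H (A \<union> B))"
    proof (rule sum.reindex_bij_witness[where j = "\<lambda>S. (S \<inter> U, S - U)" and i = "\<lambda>(A, B). A \<union> B"])
      fix S assume S: "S \<in> {S \<in> subsets_card V m. card (S \<inter> U) = k}"
      show "(S \<inter> U, S - U) \<in> subsets_card U k \<times> subsets_card (V - U) (m - k)"
        using S card_eq[of S] by (auto simp: subsets_card_def)
      show "(case (S \<inter> U, S - U) of (A, B) \<Rightarrow> A \<union> B) = S" by auto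
      have "S \<inter> U \<union> (S - U) = S" by auto
      then show "(case (S \<inter> U, S - U) of (A, B) \<Rightarrow> H (A \<union> B)) = H S" by simp
    next
      fix p assume p: "p \<in> subsets_card U k \<times> subsets_card (V - U) (m - k)"
      obtain A B where AB: "p = (A, B)" by fastforce
      have sub: "A \<subseteq> U" "B \<subseteq> V - U" "card A = k" "card B = m - k" using p by (auto simp: AB subsets_card_def)
      then have eq: "(A \<union> B) \<inter> U = A" "A \<union> B - U = B" and sV: "A \<union> B \<subseteq> V" using assms(2) by auto
      then show "((case p of (A, B) \<Rightarrow> A \<union> B) \<inter> U, (case p of (A, B) \<Rightarrow> A \<union> B) - U) = p" by (simp add: AB)
      show "(case p of (A, B) \<Rightarrow> A \<union> B) \<in> {S \<in> subsets_card V m. card (S \<inter> U) = k}"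
        using card_eq[OF sV] eq sub sV k by (simp add: AB subsets_card_def)
    qed
  qed
  also have "\<dots> = (\<Sum>k\<le>m. \<Sum>A\<in>subsets_card U k. \<Sum>B\<in>subsets_card (V - U) (m - k). H (A \<union> B))"
    by (simp add: sum.cartesian_product)
  finally show ?thesis .
qed

text \<open>The coordinates of \<open>z\<close> larger than \<open>t = m powr (- 1 / r)\<close> are estimated in \<open>\<ell>\<^sub>1\<close>, the others in
  \<open>\<ell>\<^sub>2\<close>; the threshold makes every mixed term of the expansion have the same order \<open>t ^ m\<close> up to
  factors exponential in \<open>m\<close>.\<close>

lemma sign_polynomial_lr_bound:
  fixes \<epsilon> :: "nat set \<Rightarrow> real"
  assumes m: "1 \<le> m" and r: "1 \<le> r" "r \<le> 2" and D: "0 \<le> D"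
    and small: "\<And>A k v. A \<subseteq> {..<n} \<Longrightarrow> card A + k = m \<Longrightarrow> (\<Sum>i<n. (cmod (v i))\<^sup>2) \<le> 1 \<Longrightarrow>
       cmod (\<Sum>B\<in>subsets_card ({..<n} - A) k. of_real (\<epsilon> (A \<union> B)) * (\<Prod>i\<in>B. v i)) \<le> D / sqrt (fact k)"
    and z: "(\<Sum>i<n. cmod (z i) powr r) \<le> 1"
  shows "cmod (\<Sum>S\<in>subsets_card {..<n} m. of_real (\<epsilon> S) * (\<Prod>i\<in>S. z i))
          \<le> D * (exp 2 * real m powr (- 1 / r)) ^ m"
proof -
  let ?V = "{..<n}"
  define t where "t = real m powr (- 1 / r)"
  have t: "0 < t" using m by (simp add: t_def)
  define U where "U = {i \<in> ?V. t < cmod (z i)}"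
  define v where "v i = (if i \<in> U then 0 else z i)" for i
  \<comment> \<open>\<open>s\<close> bounds the l2 norm of the small part \<open>v\<close>, so
    \<open>v\<close> divided by \<open>s\<close> is admissible in \<open>small\<close>.\<close>
  define s where "s = sqrt (real m) * t"
  have s: "0 < s" using t m by (simp add: s_def)
  have U: "U \<subseteq> ?V" "finite U" by (auto simp: U_def)
  \<comment> \<open>The choice of \<open>t\<close> serves this identity: it converts the lr bound on
    the large coordinates into the l1 bound \<open>m * t\<close>.\<close>
  have t1: "t powr (1 - r) = real m * t"
  proof -
    have "t powr (1 - r) = real m powr ((- 1 / r) * (1 - r))" by (simp add: t_def powr_powr)
    also have "(- 1 / r) * (1 - r) = 1 + (- 1 / r)" using r by (simp add: field_simps)
    also have "real m powr (1 + (- 1 / r)) = real m * t"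
      unfolding powr_add t_def using m by simp
    finally show ?thesis .
  qed
  have t2: "t powr (2 - r) = real m * t\<^sup>2"
    using powr_add[of t 1 "1 - r"] t t1 by (simp add: power2_eq_square mult_ac)
  have u_sum: "(\<Sum>i\<in>U. cmod (z i)) \<le> real m * t"
  proof -
    have "(\<Sum>i\<in>U. cmod (z i)) \<le> (\<Sum>i\<in>U. cmod (z i) powr r * (real m * t))"
    proof (rule sum_mono)
      fix i assume "i \<in> U"
      then have zi: "t < cmod (z i)" by (simp add: U_def)
      have "cmod (z i) = cmod (z i) powr r * cmod (z i) powr (1 - r)"
        using zi t by (simp flip: powr_add)
      also have "\<dots> \<le> cmod (z i) powr r * t powr (1 - r)"
        using zi t r by (intro mult_left_mono powr_mono2') auto
      finally show "cmod (z i) \<le> cmod (z i) powr r * (real m * t)" by (simp add: t1)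
    qed
    also have "\<dots> = (\<Sum>i\<in>U. cmod (z i) powr r) * (real m * t)" by (simp add: sum_distrib_right)
    also have "\<dots> \<le> 1 * (real m * t)"
    proof (rule mult_right_mono)
      have "(\<Sum>i\<in>U. cmod (z i) powr r) \<le> (\<Sum>i<n. cmod (z i) powr r)" using U by (intro sum_mono2) auto
      then show "(\<Sum>i\<in>U. cmod (z i) powr r) \<le> 1" using z by linarith
    qed (use t in simp)
    finally show ?thesis by simp
  qed
  have v_sum: "(\<Sum>i<n. (cmod (v i))\<^sup>2) \<le> s\<^sup>2"
  proof -
    have "(\<Sum>i<n. (cmod (v i))\<^sup>2) \<le> (\<Sum>i<n. cmod (z i) powr r * (real m * t\<^sup>2))"
    proof (rule sum_mono)
      fix i assume "i \<in> ?V"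
      show "(cmod (v i))\<^sup>2 \<le> cmod (z i) powr r * (real m * t\<^sup>2)"
      proof (cases "i \<in> U \<or> z i = 0")
        case False
        then have zi: "cmod (z i) \<le> t" "0 < cmod (z i)" using \<open>i \<in> ?V\<close> by (auto simp: U_def)
        have "(cmod (v i))\<^sup>2 = cmod (z i) powr 2" using False zi(2) by (simp add: v_def)
        also have "\<dots> = cmod (z i) powr r * cmod (z i) powr (2 - r)"
          using zi by (simp flip: powr_add)
        also have "\<dots> \<le> cmod (z i) powr r * t powr (2 - r)"
          using zi t r by (intro mult_left_mono powr_mono2) auto
        finally show ?thesis by (simp add: t2)
      qed (auto simp: v_def)
    qed
    also have "\<dots> = (\<Sum>i<n. cmod (z i) powr r) * (real m * t\<^sup>2)" by (simp add: sum_distrib_right)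
    also have "\<dots> \<le> 1 * (real m * t\<^sup>2)" using z by (intro mult_right_mono) auto
    also have "\<dots> = s\<^sup>2" by (simp add: s_def power_mult_distrib)
    finally show ?thesis .
  qed
  have inner: "cmod (\<Sum>B\<in>subsets_card (?V - U) (m - k). of_real (\<epsilon> (A \<union> B)) * (\<Prod>i\<in>B. z i))
      \<le> s ^ (m - k) * (D / sqrt (fact (m - k)))" if k: "k \<le> m" and A: "A \<in> subsets_card U k" for A k
  proof -
    define v' where "v' i = v i / of_real s" for i
    have AU: "A \<subseteq> U" "card A = k" using A by (auto simp: subsets_card_def)
    \<comment> \<open>As \<open>v\<close> vanishes on \<open>U\<close>, the sum may be enlarged to
      the subsets of \<open>?V - A\<close>, the form in which \<open>small\<close> is
      assumed.\<close>
    have "(\<Sum>B\<in>subsets_card (?V - U) (m - k). of_real (\<epsilon> (A \<union> B)) * (\<Prod>i\<in>B. z i))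
        = (\<Sum>B\<in>subsets_card (?V - A) (m - k). of_real (\<epsilon> (A \<union> B)) * (\<Prod>i\<in>B. v i))"
    proof (rule sum.mono_neutral_cong_left)
      show "finite (subsets_card (?V - A) (m - k))" by (simp add: finite_subsets_card)
      show "subsets_card (?V - U) (m - k) \<subseteq> subsets_card (?V - A) (m - k)"
        using AU by (auto simp: subsets_card_def)
      show "\<forall>B\<in>subsets_card (?V - A) (m - k) - subsets_card (?V - U) (m - k).
          of_real (\<epsilon> (A \<union> B)) * (\<Prod>i\<in>B. v i) = 0"
      proof
        fix B assume B: "B \<in> subsets_card (?V - A) (m - k) - subsets_card (?V - U) (m - k)"
        then have "finite B" using finite_subset[of B ?V] by (auto simp: subsets_card_def)
        moreover have "\<exists>i\<in>B. v i = 0" using B by (auto simp: subsets_card_def v_def)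
        ultimately show "of_real (\<epsilon> (A \<union> B)) * (\<Prod>i\<in>B. v i) = 0" by (simp add: prod_zero)
      qed
      fix B assume "B \<in> subsets_card (?V - U) (m - k)"
      then have "(\<Prod>i\<in>B. z i) = (\<Prod>i\<in>B. v i)" by (intro prod.cong) (auto simp: subsets_card_def v_def)
      then show "of_real (\<epsilon> (A \<union> B)) * (\<Prod>i\<in>B. z i) = of_real (\<epsilon> (A \<union> B)) * (\<Prod>i\<in>B. v i)" by simp
    qed
    also have "\<dots> = of_real s ^ (m - k) * (\<Sum>B\<in>subsets_card (?V - A) (m - k). of_real (\<epsilon> (A \<union> B)) * (\<Prod>i\<in>B. v' i))"
      unfolding sum_distrib_left
    proof (intro sum.cong refl)
      fix B assume "B \<in> subsets_card (?V - A) (m - k)"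
      then have "card B = m - k" by (simp add: subsets_card_def)
      then show "of_real (\<epsilon> (A \<union> B)) * (\<Prod>i\<in>B. v i) = of_real s ^ (m - k) * (of_real (\<epsilon> (A \<union> B)) * (\<Prod>i\<in>B. v' i))"
        using s by (simp add: v'_def prod_dividef)
    qed
    finally have eq: "(\<Sum>B\<in>subsets_card (?V - U) (m - k). of_real (\<epsilon> (A \<union> B)) * (\<Prod>i\<in>B. z i))
      = of_real s ^ (m - k) * (\<Sum>B\<in>subsets_card (?V - A) (m - k). of_real (\<epsilon> (A \<union> B)) * (\<Prod>i\<in>B. v' i))" .
    have "(\<Sum>i<n. (cmod (v' i))\<^sup>2) = (\<Sum>i<n. (cmod (v i))\<^sup>2) / s\<^sup>2"
      using s by (simp add: v'_def norm_divide power_divide sum_divide_distrib)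
    also have "\<dots> \<le> 1" using v_sum s by simp
    finally have "cmod (\<Sum>B\<in>subsets_card (?V - A) (m - k). of_real (\<epsilon> (A \<union> B)) * (\<Prod>i\<in>B. v' i)) \<le> D / sqrt (fact (m - k))"
      using small[of A "m - k" v'] AU U k by auto
    then show ?thesis
      unfolding eq norm_mult norm_power norm_of_real using s by (intro mult_mono) auto
  qed
  have "cmod (\<Sum>S\<in>subsets_card ?V m. of_real (\<epsilon> S) * (\<Prod>i\<in>S. z i))
      = cmod (\<Sum>k\<le>m. \<Sum>A\<in>subsets_card U k. (\<Prod>i\<in>A. z i) *
          (\<Sum>B\<in>subsets_card (?V - U) (m - k). of_real (\<epsilon> (A \<union> B)) * (\<Prod>i\<in>B. z i)))"
    unfolding sum_subsets_card_split[OF finite_lessThan U(1)] sum_distrib_left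
  proof (intro arg_cong[where f = cmod] sum.cong refl)
    fix k A B assume "A \<in> subsets_card U k" "B \<in> subsets_card (?V - U) (m - k)"
    then have "finite A" "finite B" "A \<inter> B = {}"
      using U finite_subset[of A U] finite_subset[of B ?V] by (auto simp: subsets_card_def)
    then show "of_real (\<epsilon> (A \<union> B)) * (\<Prod>i\<in>A \<union> B. z i) = (\<Prod>i\<in>A. z i) * (of_real (\<epsilon> (A \<union> B)) * (\<Prod>i\<in>B. z i))"
      by (simp add: prod.union_disjoint)
  qed
  also have "\<dots> \<le> (\<Sum>k\<le>m. \<Sum>A\<in>subsets_card U k. (\<Prod>i\<in>A. cmod (z i)) * (s ^ (m - k) * (D / sqrt (fact (m - k)))))"
  proof (intro sum_norm_le)
    fix k A assume "k \<in> {..m}" "A \<in> subsets_card U k"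
    then show "cmod ((\<Prod>i\<in>A. z i) * (\<Sum>B\<in>subsets_card (?V - U) (m - k). of_real (\<epsilon> (A \<union> B)) * (\<Prod>i\<in>B. z i)))
        \<le> (\<Prod>i\<in>A. cmod (z i)) * (s ^ (m - k) * (D / sqrt (fact (m - k))))"
      unfolding norm_mult prod_norm[symmetric] by (intro mult_left_mono inner) (auto simp: prod_nonneg)
  qed
  also have "\<dots> = (\<Sum>k\<le>m. (\<Sum>A\<in>subsets_card U k. \<Prod>i\<in>A. cmod (z i)) * (s ^ (m - k) * (D / sqrt (fact (m - k)))))"
    unfolding sum_distrib_right ..
  also have "\<dots> \<le> (\<Sum>k\<le>m. (real m * t) ^ k / fact k * (s ^ (m - k) * (D / sqrt (fact (m - k)))))"
  proof (intro sum_mono mult_right_mono)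
    fix k
    have "(\<Sum>A\<in>subsets_card U k. \<Prod>i\<in>A. cmod (z i)) \<le> (\<Sum>i\<in>U. cmod (z i)) ^ k / fact k"
      by (rule sum_prod_subsets_card_le) (use U in auto)
    also have "\<dots> \<le> (real m * t) ^ k / fact k"
      by (intro divide_right_mono power_mono u_sum) (auto simp: sum_nonneg)
    finally show "(\<Sum>A\<in>subsets_card U k. \<Prod>i\<in>A. cmod (z i)) \<le> (real m * t) ^ k / fact k" .
  qed (use s D in auto)
  \<comment> \<open>By \<open>s = sqrt m * t\<close> every summand carries \<open>t ^ m\<close>; the
    remaining small-coordinate factor is a square root of a term of the series of
    \<open>exp m\<close>.\<close>
  also have "\<dots> \<le> (\<Sum>k\<le>m. D * (t ^ m * exp m) * (real m ^ k / fact k))"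
  proof (rule sum_mono)
    fix k assume "k \<in> {..m}"
    then have tm: "t ^ m = t ^ k * t ^ (m - k)" by (simp flip: power_add)
    have "(sqrt (real m)) ^ (m - k) / sqrt (fact (m - k)) = sqrt (real m ^ (m - k) / fact (m - k))"
      by (simp add: real_sqrt_divide real_sqrt_power)
    also have "\<dots> \<le> sqrt (exp m)" by (intro real_sqrt_le_mono power_div_fact_le_exp) simp
    also have "\<dots> \<le> sqrt ((exp m)\<^sup>2)"
      by (intro real_sqrt_le_mono) (simp add: power2_eq_square)
    finally have e: "(sqrt (real m)) ^ (m - k) / sqrt (fact (m - k)) \<le> exp m" by simp
    have "(real m * t) ^ k / fact k * (s ^ (m - k) * (D / sqrt (fact (m - k))))
        = D * t ^ m * (real m ^ k / fact k) * ((sqrt (real m)) ^ (m - k) / sqrt (fact (m - k)))"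
      by (simp add: s_def tm power_mult_distrib)
    also have "\<dots> \<le> D * t ^ m * (real m ^ k / fact k) * exp m"
      using D t by (intro mult_left_mono e) auto
    finally show "(real m * t) ^ k / fact k * (s ^ (m - k) * (D / sqrt (fact (m - k))))
        \<le> D * (t ^ m * exp m) * (real m ^ k / fact k)" by (simp add: mult_ac)
  qed
  also have "\<dots> = D * (t ^ m * exp m) * (\<Sum>k\<le>m. real m ^ k / fact k)" by (simp add: sum_distrib_left)
  also have "\<dots> \<le> D * (t ^ m * exp m) * exp m"
    using D t by (intro mult_left_mono sum_power_div_fact_le_exp) auto
  also have "\<dots> = D * (exp 2 * t) ^ m"
  proof -
    have "exp (real m) * exp (real m) = exp (real m * 2)" by (simp flip: exp_add)
    also have "\<dots> = exp 2 ^ m" by (simp only: exp_of_nat_mult)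
    finally show ?thesis by (simp add: power_mult_distrib mult_ac)
  qed
  finally show ?thesis by (simp add: t_def)
qed

section \<open>The upper estimate\<close>

context symmetric_lattice
begin

section \<open>The norm of the identity into lr\<close>

lemma bdd_above_id_norm:
  assumes "1 \<le> r"
  shows "bdd_above ((\<lambda>z. (\<Sum>k<n. cmod (z k) powr r) powr (1 / r)) ` {z \<in> cvec n. normXn nX n z \<le> 1})"
proof (rule bdd_aboveI2)
  fix z assume "z \<in> {z \<in> cvec n. normXn nX n z \<le> 1}"
  then have z: "z \<in> Xs" "nX z \<le> 1" using cvec_in by (auto simp: normXn_eq)
  have "cmod (z k) \<le> 1 / nX (unit_seq k)" for k
    using coord_le[OF z(1), of k] z(2) norm_unit_pos[of k] by (meson divide_right_mono less_imp_le order_trans)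
  then show "(\<Sum>k<n. cmod (z k) powr r) powr (1 / r) \<le> (\<Sum>k<n. (1 / nX (unit_seq k)) powr r) powr (1 / r)"
    using assms by (intro powr_mono2 sum_mono) (auto simp: sum_nonneg)
qed

lemma id_norm_pos:
  assumes "1 \<le> r" "1 \<le> n"
  shows "0 < id_norm_lr nX n r"
proof -
  define z where "z = (\<lambda>k. of_real (1 / nX (unit_seq 0)) * unit_seq 0 k)"
  have zc: "z \<in> cvec n" using assms by (simp add: z_def cvec_def unit_seq_def)
  have "nX z = 1"
    unfolding z_def norm_scale[OF unit_in] norm_of_real using norm_unit_pos[of 0] by simp
  have "0 < cmod (z 0) powr r" using norm_unit_pos[of 0] by (simp add: z_def unit_seq_def)
  also have "\<dots> \<le> (\<Sum>k<n. cmod (z k) powr r)" using assms by (intro member_le_sum) auto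
  finally have "0 < (\<Sum>k<n. cmod (z k) powr r) powr (1 / r)" by simp
  also have "\<dots> \<le> id_norm_lr nX n r"
    unfolding id_norm_lr_def using zc \<open>nX z = 1\<close>
    by (intro cSUP_upper bdd_above_id_norm assms) (auto simp: normXn_eq)
  finally show ?thesis .
qed

lemma sum_powr_le_id_norm:
  assumes "1 \<le> r" "z \<in> cvec n" "nX z \<le> 1"
  shows "(\<Sum>k<n. cmod (z k) powr r) \<le> id_norm_lr nX n r powr r"
proof -
  have "(\<Sum>k<n. cmod (z k) powr r) powr (1 / r) \<le> id_norm_lr nX n r"
    unfolding id_norm_lr_def using assms
    by (intro cSUP_upper bdd_above_id_norm) (auto simp: normXn_eq)
  then have "((\<Sum>k<n. cmod (z k) powr r) powr (1 / r)) powr r \<le> id_norm_lr nX n r powr r"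
    using assms by (intro powr_mono2) auto
  then show ?thesis using assms by (simp add: powr_powr sum_nonneg)
qed

text \<open>Bohr's inequality for the sign polynomial at a constant vector gives
  \<open>(n choose m) * \<sigma> ^ m \<le> E ^ m\<close>; since
  \<open>(n / m) ^ m \<le> n choose m\<close>, taking roots yields
  \<open>n / m * \<sigma> \<le> E\<close>. The constant is \<open>198 = 2 * 33 * 3\<close>.\<close>

lemma bohr_set_upper:
  assumes n: "2 \<le> n" and r: "1 \<le> r" "r \<le> 2" and \<rho>: "\<rho> \<in> bohr_set n"
  shows "\<rho> \<le> 198 * exp 5 * ln (real n) powr (1 - 1 / r) / phi_dual Xs nX n * id_norm_lr nX n r"
proof -
  let ?V = "{..<n}"
  \<comment> \<open>The least natural number with \<open>n \<le> exp m\<close>: the factor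
    \<open>n ^ 3\<close> then costs only \<open>exp 3\<close> after taking roots.\<close>
  define m where "m = nat \<lceil>ln (real n)\<rceil>"
  have ln2: "2 / 3 \<le> ln (real n)"
  proof -
    have "2 / 3 \<le> ln (2::real)" by (rule ln2_ge_two_thirds)
    also have "\<dots> \<le> ln (real n)" using n by simp
    finally show ?thesis .
  qed
  have m1: "1 \<le> m" and lm: "ln (real n) \<le> real m" and m3: "real m \<le> 3 * ln (real n)"
    using ln2 unfolding m_def by linarith+
  have mn: "m \<le> n"
  proof -
    have "ln (real n) \<le> real n - 1" using n by (intro ln_le_minus_one) auto
    then show ?thesis unfolding m_def by linarith
  qed
  have ne: "real n \<le> exp (real m)"
  proof -
    have "real n = exp (ln (real n))" using n by simp
    also have "\<dots> \<le> exp (real m)" using lm by simp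
    finally show ?thesis .
  qed
  define b where "b = id_norm_lr nX n r"
  have b: "0 < b" using id_norm_pos[OF r(1), of n] n by (simp add: b_def)
  define t where "t = real m powr (- 1 / r)"
  have t: "0 < t" using m1 by (simp add: t_def)
  obtain \<epsilon> :: "nat set \<Rightarrow> real" where \<epsilon>: "\<And>S. \<bar>\<epsilon> S\<bar> = 1"
    "\<And>A k v. A \<subseteq> ?V \<Longrightarrow> card A + k = m \<Longrightarrow> (\<Sum>i<n. (cmod (v i))\<^sup>2) \<le> 1 \<Longrightarrow>
       cmod (\<Sum>B\<in>subsets_card (?V - A) k. of_real (\<epsilon> (A \<union> B)) * (\<Prod>i\<in>B. v i)) \<le> 33 * real n ^ 3 / sqrt (fact k)"
    using exists_sign_polynomial[of n m] n mn by auto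
  define c where "c = hom_part m (\<lambda>S. of_real (\<epsilon> S))"
  define f where "f = tetra ?V c"
  \<comment> \<open>\<open>exp 5\<close> collects \<open>exp 3\<close> from \<open>n ^ 3\<close> and
    \<open>exp 2\<close> from the lr bound; 33 is enlarged to \<open>33 ^ m\<close> before the
    root.\<close>
  define E where "E = 33 * exp 5 * (b * t)"
  have E: "0 < E" using b t by (simp add: E_def)
  have f_bd: "cmod (f z) \<le> E ^ m" if z: "z \<in> ballXn nX n 1" for z
  proof -
    define y where "y i = z i / of_real b" for i
    have zc: "z \<in> cvec n" "nX z \<le> 1" using z by (auto simp: ballXn_eq)
    have "(\<Sum>i<n. cmod (y i) powr r) = (\<Sum>i<n. cmod (z i) powr r) / b powr r"
      using b by (simp add: y_def norm_divide powr_divide sum_divide_distrib)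
    also have "\<dots> \<le> 1" using sum_powr_le_id_norm[OF r(1) zc] b by (simp add: b_def)
    finally have y: "(\<Sum>i<n. cmod (y i) powr r) \<le> 1" .
    have "z = (\<lambda>i. of_real b * y i)" using b by (simp add: y_def)
    then have "f z = of_real b ^ m * tetra ?V c y"
      using tetra_hom_part_scale[of ?V m _ "of_real b" y] by (simp add: f_def c_def)
    then have "cmod (f z) = b ^ m * cmod (\<Sum>S\<in>subsets_card ?V m. of_real (\<epsilon> S) * (\<Prod>i\<in>S. y i))"
      using b by (simp add: c_def tetra_hom_part norm_mult norm_power)
    also have "\<dots> \<le> b ^ m * (33 * real n ^ 3 * (exp 2 * t) ^ m)"
      unfolding t_def using b
      by (intro mult_left_mono sign_polynomial_lr_bound[OF m1 r _ \<epsilon>(2) y]) auto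
    also have "\<dots> \<le> b ^ m * (33 ^ m * exp 3 ^ m * (exp 2 * t) ^ m)"
    proof -
      have "real n ^ 3 \<le> exp (real m) ^ 3" using ne by (intro power_mono) auto
      also have "\<dots> = exp (real m * 3)" by (simp add: exp_of_nat_mult[symmetric] mult.commute)
      also have "\<dots> = exp 3 ^ m" by (simp only: exp_of_nat_mult)
      finally have "33 * real n ^ 3 \<le> 33 ^ m * exp 3 ^ m"
        using m1 self_le_power[of "33::real" m] by (intro mult_mono) auto
      then show ?thesis using b t by (intro mult_left_mono mult_right_mono) auto
    qed
    also have "\<dots> = E ^ m"
    proof -
      have "exp (5::real) = exp 3 * exp 2" by (simp flip: exp_add)
      then show ?thesis by (simp add: E_def power_mult_distrib mult_ac)
    qed
    finally show ?thesis .
  qed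
  have zero_ball: "(\<lambda>_. 0) \<in> ballXn nX n 1" by (simp add: ballXn_eq cvec_def norm_zero)
  have sup: "(SUP w\<in>ballXn nX n 1. cmod (f w)) \<le> E ^ m"
    by (rule cSUP_least) (use zero_ball f_bd in auto)
  have \<rho>0: "0 < \<rho>" using \<rho> by (simp add: bohr_set_def)
  have phi: "0 < phi n" "0 < phi_dual Xs nX n" using n phi_pos phi_dual_pos by auto
  \<comment> \<open>Halving puts the constant vector strictly inside the ball of radius
    \<rho>.\<close>
  define \<sigma> where "\<sigma> = \<rho> / (2 * phi n)"
  have \<sigma>: "0 < \<sigma>" using \<rho>0 phi by (simp add: \<sigma>_def)
  define z0 :: "nat \<Rightarrow> complex" where "z0 = (\<lambda>i. of_real \<sigma> * (if i < n then 1 else 0))"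
  have z0: "z0 \<in> ballXn nX n \<rho>"
  proof -
    have "nX z0 = \<sigma> * phi n"
      unfolding z0_def norm_scale[OF ones_in] phi_def norm_of_real using \<sigma> by simp
    also have "\<dots> < \<rho>" using phi \<rho>0 by (simp add: \<sigma>_def)
    finally show ?thesis by (simp add: ballXn_eq z0_def cvec_def)
  qed
  have "holo_on n f (ballXn nX n 1)" unfolding f_def by (rule holo_on_tetra) simp
  moreover have "\<exists>M. \<forall>z\<in>ballXn nX n 1. cmod (f z) \<le> M" using f_bd by blast
  moreover have "\<forall>\<alpha>\<in>mindex n. \<alpha> \<notin> LambdaT n \<longrightarrow> taylor_coeff n \<alpha> f = 0"
    unfolding f_def using taylor_coeff_tetra_eq_0 by blast
  ultimately have "(\<Sum>\<alpha>\<in>LambdaT n. cmod (taylor_coeff n \<alpha> f * mpow n z0 \<alpha>)) \<le> (SUP w\<in>ballXn nX n 1. cmod (f w))"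
    using \<rho> z0 unfolding bohr_set_def by blast
  also have "(\<Sum>\<alpha>\<in>LambdaT n. cmod (taylor_coeff n \<alpha> f * mpow n z0 \<alpha>)) = real (n choose m) * \<sigma> ^ m"
  proof -
    have "(\<Sum>S\<in>Pow ?V. cmod (taylor_coeff n (set_index S) f) * (\<Prod>i\<in>S. cmod (z0 i)))
        = (\<Sum>S\<in>subsets_card ?V m. \<sigma> ^ m)"
    proof (rule sum.mono_neutral_cong_right)
      show "\<forall>S\<in>Pow ?V - subsets_card ?V m. cmod (taylor_coeff n (set_index S) f) * (\<Prod>i\<in>S. cmod (z0 i)) = 0"
        by (auto simp: f_def taylor_coeff_tetra c_def hom_part_def subsets_card_def)
      fix S assume S: "S \<in> subsets_card ?V m"
      then have "(\<Prod>i\<in>S. cmod (z0 i)) = (\<Prod>i\<in>S. \<sigma>)"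
        using \<sigma> by (intro prod.cong) (auto simp: subsets_card_def z0_def norm_mult)
      then show "cmod (taylor_coeff n (set_index S) f) * (\<Prod>i\<in>S. cmod (z0 i)) = \<sigma> ^ m"
        using S \<epsilon>(1)[of S] by (simp add: f_def taylor_coeff_tetra c_def hom_part_def subsets_card_def)
    qed (auto simp: subsets_card_def)
    then show ?thesis by (simp add: sum_LambdaT card_subsets_card)
  qed
  finally have "real (n choose m) * \<sigma> ^ m \<le> E ^ m" using sup by linarith
  moreover have "(real n / real m) ^ m * \<sigma> ^ m \<le> real (n choose m) * \<sigma> ^ m"
    using \<sigma> by (intro mult_right_mono binomial_ge_n_over_k_pow_k mn) auto
  ultimately have "(real n / real m * \<sigma>) ^ m \<le> E ^ m"
    unfolding power_mult_distrib by linarith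
  then have "real n / real m * \<sigma> \<le> E"
    using E m1 power_le_imp_le_base[of "real n / real m * \<sigma>" "m - 1" E] by simp
  then have ns: "real n * \<sigma> \<le> 33 * exp 5 * b * (real m * t)"
    using m1 by (simp add: E_def field_simps)
  \<comment> \<open>The product is \<open>m powr (1 - 1 / r)\<close>, and
    \<open>m \<le> 3 * ln n\<close> makes it the logarithmic factor, \<open>1 - 1 / r\<close> being
    the reciprocal of the conjugate exponent.\<close>
  have mt: "real m * t \<le> 3 * ln (real n) powr (1 - 1 / r)"
  proof -
    have "real m * t = real m powr (1 + - 1 / r)" unfolding t_def powr_add using m1 by simp
    also have "\<dots> = real m powr (1 - 1 / r)" by simp
    also have "\<dots> \<le> (3 * ln (real n)) powr (1 - 1 / r)" using m3 m1 r by (intro powr_mono2) auto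
    also have "\<dots> = 3 powr (1 - 1 / r) * ln (real n) powr (1 - 1 / r)" using ln2 by (simp add: powr_mult)
    also have "\<dots> \<le> 3 powr 1 * ln (real n) powr (1 - 1 / r)"
      using r by (intro mult_right_mono powr_mono) auto
    finally show ?thesis by simp
  qed
  \<comment> \<open>The product bound for the two fundamental functions replaces
    \<open>phi n\<close> by the dual one.\<close>
  have "\<rho> * phi_dual Xs nX n \<le> \<rho> * (real n / phi n)"
    using phi_dual_phi_le[of n] phi \<rho>0 by (intro mult_left_mono) (auto simp: field_simps)
  also have "\<dots> = 2 * (real n * \<sigma>)" by (simp add: \<sigma>_def)
  also have "\<dots> \<le> 2 * (33 * exp 5 * b * (3 * ln (real n) powr (1 - 1 / r)))"
  proof (rule mult_left_mono)
    have "33 * exp 5 * b * (real m * t) \<le> 33 * exp 5 * b * (3 * ln (real n) powr (1 - 1 / r))"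
      using b by (intro mult_left_mono mt) auto
    then show "real n * \<sigma> \<le> 33 * exp 5 * b * (3 * ln (real n) powr (1 - 1 / r))" using ns by linarith
  qed simp
  finally show ?thesis using phi by (simp add: b_def field_simps)
qed

end

text \<open>The constants are 18 and \<open>198 * exp 5\<close>, uniform in the lattice and in
  \<open>r\<close>. The upper bound starts at \<open>n = 2\<close>: for \<open>n = 1\<close> its
  right-hand side is 0 because \<open>ln 1 = 0\<close>, while the Bohr radius is positive.\<close>

theorem theorem2p32:
  fixes Xs :: "(nat \<Rightarrow> complex) set" and nX :: "(nat \<Rightarrow> complex) \<Rightarrow> real"
  assumes "symmetric_banach_seq_lattice Xs nX"
  shows "(\<exists>C>0. \<forall>n\<ge>1.
            (INF m\<in>{1..n}. lower_ratio Xs nX n m) \<le> C * bohr_radius nX n (LambdaT n))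
       \<and> (\<forall>r::real. 1 \<le> r \<and> r \<le> 2 \<longrightarrow>
            (\<exists>C>0. \<forall>n\<ge>2.
               bohr_radius nX n (LambdaT n)
                 \<le> C * ln (real n) powr (1 - 1 / r) / phi_dual Xs nX n * id_norm_lr nX n r))"
proof -
  interpret symmetric_lattice Xs nX by unfold_locales (rule assms)
  have "bohr_radius nX n (LambdaT n)
      \<le> 198 * exp 5 * ln (real n) powr (1 - 1 / r) / phi_dual Xs nX n * id_norm_lr nX n r"
    if "1 \<le> r" "r \<le> 2" "2 \<le> n" for r n
    unfolding bohr_radius_eq
  proof (rule cSup_least)
    show "bohr_set n \<noteq> {}" using bohr_set_lower[of n] that by auto
  qed (use bohr_set_upper that in auto)
  moreover have "0 < 198 * exp (5::real)" by simp
  ultimately show ?thesis using bohr_radius_lower by (meson zero_less_numeral)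
qed

end
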